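(* Let $p$ be an odd prime and $n\ge0$ an integer. Let $K$ be the complete graph on the vertices $\{1,2,2p,2p^2,\dots,2p^n\}$ considered as a directed graph, with edges labelled by elements of $A^\vee(n)$ as in the context. I. For $i\ge1$, $j\ge0$ with $i+j\le n$, the coproduct $\psi(\xi_i^{p^j})\in A^\vee(n)\otimes A^\vee(n)$ is the sum of tensors of all pairs of edges that make length $2$ directed paths (degenerate paths included) from the vertex $2p^j$ to the vertex $2p^{i+j}$ in $K$. II. Similarly, for $0\le i\le n$, the coproduct $\psi(\tau_i)$ is the sum of tensors of all pairs of edges that make length $2$ directed paths (degenerate paths included) from the vertex $1$ to the vertex $2p^i$ in $K$. Here the tensor of a pair of consecutive edges $v\xrightarrow{e}w\xrightarrow{e'}z$ is (label of $e'$)$\,\otimes\,$(label of $e$).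
   Context: $A^\vee(n)=\mathbb{F}_p[\xi_1,\dots,\xi_n,\tau_0,\dots,\tau_n]/(\xi_1^{p^n},\xi_2^{p^{n-1}},\dots,\xi_n^{p},\tau_0^2,\dots,\tau_n^2)$ (the $\tau_i$ are exterior generators) is a quotient Hopf algebra over $\mathbb{F}_p$ of the mod $p$ dual Steenrod algebra, with $|\xi_i|=2(p^i-1)$, $|\tau_i|=2p^i-1$. Its coproduct $\psi:A^\vee(n)\to A^\vee(n)\otimes_{\mathbb{F}_p}A^\vee(n)$ is the algebra homomorphism with $\psi(\xi_m)=\sum_{k=0}^m\xi_{m-k}^{p^k}\otimes\xi_k$ and $\psi(\tau_m)=\tau_m\otimes1+\sum_{k=0}^m\xi_{m-k}^{p^k}\otimes\tau_k$, where $\xi_0=1$. In the complete directed graph $K$, every edge is directed towards its larger end; the edge $2p^a\to2p^b$ ($a<b$) is labelled $\xi_{b-a}^{p^a}$ and the edge $1\to2p^a$ is labelled $\tau_a$. Degenerate length $2$ paths from $v$ to $z$ are those consisting of the edge $v\to z$ together with a loop at $v$ (traversed before the edge) or a loop at $z$ (traversed after the edge); a loop is labelled $1$. *)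

theory Defs
  imports
    "HOL-Algebra.QuotRing"
    "HOL-Library.Poly_Mapping"
    "Berlekamp_Zassenhaus.Finite_Field"
begin

text \<open>
  The prime is \<open>p = CARD('p)\<close> for a type \<open>'p\<close> of class \<open>prime_card\<close>, and \<open>\<F>\<^sub>p\<close> is the type
  \<open>'p mod_ring\<close>.

  \<open>A\<^sup>\<or>(n)\<close> is neither commutative nor (for varying \<open>n\<close>) a type, so it is a quotient, by a two-sided
  ideal, of the free associative algebra on \<open>\<xi>\<^sub>1,\<dots>,\<xi>\<^sub>n,\<tau>\<^sub>0,\<dots>,\<tau>\<^sub>n\<close>. The free algebra is the monoid
  algebra of the free monoid, written additively because \<^typ>\<open>'a \<Rightarrow>\<^sub>0 'b\<close> requires this.
\<close>

datatype gen = Xi nat | Tau nat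

datatype gword = GWord (letters: "gen list")

instantiation gword :: monoid_add
begin

definition zero_gword :: gword where
  "zero_gword = GWord []"

definition plus_gword :: "gword \<Rightarrow> gword \<Rightarrow> gword" where
  "plus_gword u v = GWord (letters u @ letters v)"

instance
  by standard (simp_all add: zero_gword_def plus_gword_def)

end

type_synonym 'p free_elt = "gword \<Rightarrow>\<^sub>0 'p mod_ring"
type_synonym 'p dsa_elt = "'p free_elt set"
type_synonym 'p pair_comb = "('p dsa_elt \<times> 'p dsa_elt) \<Rightarrow>\<^sub>0 'p mod_ring"
type_synonym 'p tensor_elt = "'p pair_comb set"


subsection \<open>The algebra \<open>A\<^sup>\<or>(n)\<close>\<close>

definition gens :: "nat \<Rightarrow> gen set" where
  "gens n = Xi ` {1..n} \<union> Tau ` {0..n}"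

definition free_alg :: "nat \<Rightarrow> 'p::prime_card free_elt ring" where
  "free_alg n =
    \<lparr>carrier = {f. \<forall>w\<in>Poly_Mapping.keys f. set (letters w) \<subseteq> gens n},
     monoid.mult = (*), one = 1, zero = 0, add = (+)\<rparr>"

definition var :: "gen \<Rightarrow> 'p::prime_card free_elt" where
  "var g = Poly_Mapping.single (GWord [g]) 1"

definition dsa_relations :: "nat \<Rightarrow> 'p::prime_card free_elt set" where
  "dsa_relations n =
     {var (Xi i) * var g - var g * var (Xi i) | i g. i \<in> {1..n} \<and> g \<in> gens n}
   \<union> {var (Tau i) * var (Tau j) + var (Tau j) * var (Tau i) | i j. i \<le> n \<and> j \<le> n}
   \<union> {var (Xi i) ^ (CARD('p) ^ (n + 1 - i)) | i. i \<in> {1..n}}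
   \<union> {var (Tau i) ^ 2 | i. i \<le> n}"

definition dsa_ideal :: "nat \<Rightarrow> 'p::prime_card free_elt set" where
  "dsa_ideal n = genideal (free_alg n) (dsa_relations n)"

definition dsa :: "nat \<Rightarrow> 'p::prime_card dsa_elt ring" where
  "dsa n = free_alg n Quot dsa_ideal n"

definition dsa_class :: "nat \<Rightarrow> 'p::prime_card free_elt \<Rightarrow> 'p dsa_elt" where
  "dsa_class n f = dsa_ideal n +>\<^bsub>free_alg n\<^esub> f"

definition xi :: "nat \<Rightarrow> nat \<Rightarrow> 'p::prime_card dsa_elt" where
  "xi n i = (if i = 0 then \<one>\<^bsub>dsa n\<^esub> else dsa_class n (var (Xi i)))"

definition tau :: "nat \<Rightarrow> nat \<Rightarrow> 'p::prime_card dsa_elt" where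
  "tau n i = dsa_class n (var (Tau i))"

definition dsa_scale :: "nat \<Rightarrow> 'p mod_ring \<Rightarrow> 'p::prime_card dsa_elt \<Rightarrow> 'p dsa_elt" where
  "dsa_scale n c a = dsa_class n (Poly_Mapping.single 0 c) \<otimes>\<^bsub>dsa n\<^esub> a"


subsection \<open>The grading\<close>

fun gen_degree :: "nat \<Rightarrow> gen \<Rightarrow> nat" where
  "gen_degree p (Xi i) = 2 * (p ^ i - 1)"
| "gen_degree p (Tau i) = 2 * p ^ i - 1"

definition word_degree :: "nat \<Rightarrow> gword \<Rightarrow> nat" where
  "word_degree p w = sum_list (map (gen_degree p) (letters w))"

text \<open>
  Koszul signs only depend on degrees modulo 2. \<open>free_part s\<close> and \<open>dsa_part n s\<close> are the projections
  to the sum of the components of degree congruent to \<open>s\<close> modulo 2; all defining relations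
  are homogeneous, so the second one does not depend on the representative.
\<close>

definition free_part :: "nat \<Rightarrow> 'p::prime_card free_elt \<Rightarrow> 'p free_elt" where
  "free_part s f =
    (\<Sum>w | w \<in> Poly_Mapping.keys f \<and> word_degree CARD('p) w mod 2 = s.
       Poly_Mapping.single w (Poly_Mapping.lookup f w))"

definition dsa_part :: "nat \<Rightarrow> nat \<Rightarrow> 'p::prime_card dsa_elt \<Rightarrow> 'p dsa_elt" where
  "dsa_part n s a = (\<Union>f\<in>a. dsa_class n (free_part s f))"


subsection \<open>The graded tensor product \<open>A\<^sup>\<or>(n) \<otimes> A\<^sup>\<or>(n)\<close> over \<open>\<F>\<^sub>p\<close>\<close>

text \<open>
  The underlying vector space is the free \<open>\<F>\<^sub>p\<close>-vector space on the pairs of elements of \<open>A\<^sup>\<or>(n)\<close>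
  modulo the subspace spanned by the bilinearity relations.
\<close>

definition pair_space :: "nat \<Rightarrow> 'p::prime_card pair_comb set" where
  "pair_space n = {v. Poly_Mapping.keys v \<subseteq> carrier (dsa n) \<times> carrier (dsa n)}"

definition pair_scale :: "'p::prime_card mod_ring \<Rightarrow> 'p pair_comb \<Rightarrow> 'p pair_comb" where
  "pair_scale c v = Poly_Mapping.map ((*) c) v"

definition bilinear_relations :: "nat \<Rightarrow> 'p::prime_card pair_comb set" where
  "bilinear_relations n =
     {Poly_Mapping.single (a \<oplus>\<^bsub>dsa n\<^esub> a', b) 1
        - Poly_Mapping.single (a, b) 1 - Poly_Mapping.single (a', b) 1 | a a' b.
        a \<in> carrier (dsa n) \<and> a' \<in> carrier (dsa n) \<and> b \<in> carrier (dsa n)}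
   \<union> {Poly_Mapping.single (a, b \<oplus>\<^bsub>dsa n\<^esub> b') 1
        - Poly_Mapping.single (a, b) 1 - Poly_Mapping.single (a, b') 1 | a b b'.
        a \<in> carrier (dsa n) \<and> b \<in> carrier (dsa n) \<and> b' \<in> carrier (dsa n)}
   \<union> {Poly_Mapping.single (dsa_scale n c a, b) 1 - Poly_Mapping.single (a, b) c | c a b.
        a \<in> carrier (dsa n) \<and> b \<in> carrier (dsa n)}
   \<union> {Poly_Mapping.single (a, dsa_scale n c b) 1 - Poly_Mapping.single (a, b) c | c a b.
        a \<in> carrier (dsa n) \<and> b \<in> carrier (dsa n)}"

definition bilinear_subspace :: "nat \<Rightarrow> 'p::prime_card pair_comb set" where
  "bilinear_subspace n = module.span pair_scale (bilinear_relations n)"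

definition tensor_class :: "nat \<Rightarrow> 'p::prime_card pair_comb \<Rightarrow> 'p tensor_elt" where
  "tensor_class n v = (+) v ` bilinear_subspace n"

definition tens :: "nat \<Rightarrow> 'p::prime_card dsa_elt \<Rightarrow> 'p dsa_elt \<Rightarrow> 'p tensor_elt" where
  "tens n a b = tensor_class n (Poly_Mapping.single (a, b) 1)"

text \<open>
  The multiplication is the bilinear extension of
  \<open>(a \<otimes> b)(c \<otimes> d) = (-1)\<^bsup>|b||c|\<^esup> ac \<otimes> bd\<close> for homogeneous \<open>b\<close> and \<open>c\<close>;
  for arbitrary \<open>b\<close> and \<open>c\<close> one first splits them into their even and odd parts.
\<close>

definition pair_mult ::
    "nat \<Rightarrow> 'p::prime_card pair_comb \<Rightarrow> 'p pair_comb \<Rightarrow> 'p pair_comb" where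
  "pair_mult n v w =
    (\<Sum>(a, b)\<in>Poly_Mapping.keys v. \<Sum>(c, d)\<in>Poly_Mapping.keys w. \<Sum>s\<in>{0, 1}. \<Sum>t\<in>{0, 1}.
       Poly_Mapping.single (a \<otimes>\<^bsub>dsa n\<^esub> dsa_part n t c, dsa_part n s b \<otimes>\<^bsub>dsa n\<^esub> d)
         ((- 1) ^ (s * t) * Poly_Mapping.lookup v (a, b) * Poly_Mapping.lookup w (c, d)))"

definition dsa_tensor :: "nat \<Rightarrow> 'p::prime_card tensor_elt ring" where
  "dsa_tensor n =
    \<lparr>carrier = tensor_class n ` pair_space n,
     monoid.mult = (\<lambda>X Y. \<Union>v\<in>X. \<Union>w\<in>Y. tensor_class n (pair_mult n v w)),
     one = tens n \<one>\<^bsub>dsa n\<^esub> \<one>\<^bsub>dsa n\<^esub>,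
     zero = bilinear_subspace n,
     add = (\<lambda>X Y. \<Union>v\<in>X. \<Union>w\<in>Y. tensor_class n (v + w))\<rparr>"

definition tensor_scale :: "nat \<Rightarrow> 'p::prime_card mod_ring \<Rightarrow> 'p tensor_elt \<Rightarrow> 'p tensor_elt" where
  "tensor_scale n c X = (\<Union>v\<in>X. tensor_class n (pair_scale c v))"


subsection \<open>The coproduct\<close>

definition is_coproduct :: "nat \<Rightarrow> ('p::prime_card dsa_elt \<Rightarrow> 'p tensor_elt) \<Rightarrow> bool" where
  "is_coproduct n \<psi> \<longleftrightarrow>
     \<psi> \<in> Ring.ring_hom (dsa n) (dsa_tensor n)
   \<and> (\<forall>c. \<forall>a\<in>carrier (dsa n). \<psi> (dsa_scale n c a) = tensor_scale n c (\<psi> a))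
   \<and> (\<forall>m\<in>{1..n}. \<psi> (xi n m) =
        (\<Oplus>\<^bsub>dsa_tensor n\<^esub>k\<in>{0..m}.
           tens n (xi n (m - k) [^]\<^bsub>dsa n\<^esub> (CARD('p) ^ k)) (xi n k)))
   \<and> (\<forall>m\<in>{0..n}. \<psi> (tau n m) =
        tens n (tau n m) \<one>\<^bsub>dsa n\<^esub> \<oplus>\<^bsub>dsa_tensor n\<^esub>
        (\<Oplus>\<^bsub>dsa_tensor n\<^esub>k\<in>{0..m}.
           tens n (xi n (m - k) [^]\<^bsub>dsa n\<^esub> (CARD('p) ^ k)) (tau n k)))"


subsection \<open>The labelled directed graph \<open>K\<close>\<close>

definition K_verts :: "nat \<Rightarrow> nat \<Rightarrow> nat set" where
  "K_verts p n = insert 1 ((\<lambda>a. 2 * p ^ a) ` {0..n})"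

definition K_edges :: "nat \<Rightarrow> nat \<Rightarrow> (nat \<times> nat) set" where
  "K_edges p n = {(v, w). v \<in> K_verts p n \<and> w \<in> K_verts p n \<and> v < w}"

definition vertex_exponent :: "nat \<Rightarrow> nat \<Rightarrow> nat" where
  "vertex_exponent p v = (THE a. v = 2 * p ^ a)"

text \<open>Loops \<open>(v, v)\<close> are not edges of \<open>K\<close>, but they occur in degenerate paths and have label 1.\<close>

fun edge_label :: "nat \<Rightarrow> nat \<times> nat \<Rightarrow> 'p::prime_card dsa_elt" where
  "edge_label n (v, w) =
    (if v = w then \<one>\<^bsub>dsa n\<^esub>
     else if v = 1 then tau n (vertex_exponent CARD('p) w)
     else xi n (vertex_exponent CARD('p) w - vertex_exponent CARD('p) v)
            [^]\<^bsub>dsa n\<^esub> (CARD('p) ^ vertex_exponent CARD('p) v))"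

text \<open>A path of length 2 is the pair of its edges in the order in which they are traversed.\<close>

definition nondegenerate_paths2 ::
    "nat \<Rightarrow> nat \<Rightarrow> nat \<Rightarrow> nat \<Rightarrow> ((nat \<times> nat) \<times> (nat \<times> nat)) set" where
  "nondegenerate_paths2 p n v z =
     {((v, w), (w, z)) | w. (v, w) \<in> K_edges p n \<and> (w, z) \<in> K_edges p n}"

definition degenerate_paths2 ::
    "nat \<Rightarrow> nat \<Rightarrow> nat \<Rightarrow> nat \<Rightarrow> ((nat \<times> nat) \<times> (nat \<times> nat)) set" where
  "degenerate_paths2 p n v z =
     (if (v, z) \<in> K_edges p n then {((v, v), (v, z)), ((v, z), (z, z))} else {})"

definition paths2 :: "nat \<Rightarrow> nat \<Rightarrow> nat \<Rightarrow> nat \<Rightarrow> ((nat \<times> nat) \<times> (nat \<times> nat)) set" where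
  "paths2 p n v z = nondegenerate_paths2 p n v z \<union> degenerate_paths2 p n v z"

definition path_tensor ::
    "nat \<Rightarrow> (nat \<times> nat) \<times> (nat \<times> nat) \<Rightarrow> 'p::prime_card tensor_elt" where
  "path_tensor n = (\<lambda>(e, e'). tens n (edge_label n e') (edge_label n e))"

end

theory Submission
  imports Defs
begin

text \<open>
  The graded tensor square of \<open>A\<^sup>\<or>(n)\<close> is a ring of characteristic \<open>p\<close>. The terms
  \<open>\<xi>\<^sub>i\<^sub>-\<^sub>k\<^bsup>p^k\<^esup> \<otimes> \<xi>\<^sub>k\<close> of \<open>\<psi>(\<xi>\<^sub>i)\<close> have even factors, so they commute without signs and the Frobenius map
  distributes over their sum: \<open>\<psi>(\<xi>\<^sub>i)\<^bsup>p^j\<^esup>\<close> is the sum of the tensors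
  \<open>\<xi>\<^sub>i\<^sub>-\<^sub>k\<^bsup>p^(j+k)\<^esup> \<otimes> \<xi>\<^sub>k\<^bsup>p^j\<^esup>\<close>. These are the labels along the paths through \<open>2p\<^bsup>j+k\<^esup>\<close>, where the
  values \<open>k = 0\<close> and \<open>k = i\<close> give the degenerate paths. No power is taken in the case of \<open>\<tau>\<^sub>i\<close>,
  and there the additional term \<open>\<tau>\<^sub>i \<otimes> 1\<close> is the path with a loop at \<open>1\<close>.
\<close>

section \<open>Frobenius for commuting elements and other preliminaries\<close>

text \<open>Neither \<open>dsa n\<close> nor \<open>dsa_tensor n\<close> is commutative in general,
  so the Frobenius identity is needed for commuting elements of an arbitrary ring. The larger
  obstacle is that \<open>dsa_tensor n\<close> is a ring at all: its product is a union over
  representatives, with Koszul signs expressed through parity projections. Three facts have to be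
  chained. The defining ideal of the algebra is generated by parity-homogeneous elements, hence the
  projections descend to linear maps of the quotient. Hence, for a fixed factor, the product of
  pairs is a signed sum of maps g \<otimes> h with g and h linear, and such maps preserve the
  bilinear relations. Hence the product does not depend on representatives. Associativity is then a
  comparison of signs on homogeneous pure tensors. Sums over paths are sums over sets, so the
  indexing of paths by their middle vertex also has to be injective.\<close>

context ring
begin

lemma add_pow_add:
  "x \<in> carrier R \<Longrightarrow> [(j + k::nat)] \<cdot> x = [j] \<cdot> x \<oplus> [k] \<cdot> x"
  by (simp add: add.nat_pow_mult)

text \<open>Multiplying the expansion on the right by x + y needs only that x can be moved to the
  left through powers of y; the rest is Pascal's rule.\<close>

lemma binomial_commuting:
  assumes x: "x \<in> carrier R" and y: "y \<in> carrier R" and xy: "x \<otimes> y = y \<otimes> x"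
  shows "(x \<oplus> y) [^] (n::nat) = (\<Oplus>k\<in>{..n}. [(n choose k)] \<cdot> (x [^] k \<otimes> y [^] (n - k)))"
proof (induction n)
  case 0
  then show ?case by simp
next
  case (Suc n)
  let ?f = "\<lambda>n k. [(n choose k)] \<cdot> (x [^] k \<otimes> y [^] (n - k))"
  have cl: "?f m k \<in> carrier R" for m k using x y by simp
  have yk: "y [^] k \<otimes> x = x \<otimes> y [^] k" for k :: nat
    using group_commutes_pow[of y x k] x y xy by simp
  have fx: "?f n k \<otimes> x = [(n choose k)] \<cdot> (x [^] Suc k \<otimes> y [^] (n - k))" for k
    using x y yk[of "n - k"] by (simp add: add_pow_ldistr m_assoc)
  have fy: "?f n k \<otimes> y = [(n choose k)] \<cdot> (x [^] k \<otimes> y [^] Suc (n - k))" for k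
    using x y by (simp add: add_pow_ldistr m_assoc)
  \<comment> \<open>Pascal's rule splits the coefficient; its first half is the product with
    \<open>x\<close> computed in \<open>fx\<close>.\<close>
  have step: "?f (Suc n) (Suc k) = ?f n k \<otimes> x \<oplus> [(n choose Suc k)] \<cdot> (x [^] Suc k \<otimes> y [^] (n - k))" for k
    using x y unfolding fx by (simp add: add_pow_add)
  \<comment> \<open>The sum is extended to \<open>Suc n\<close>, where the binomial coefficient
    vanishes, and then shifted by one, so that it runs over the same index as the product with
    \<open>x\<close>; the term at 0 is left over.\<close>
  have sy: "(\<Oplus>k\<in>{..n}. ?f n k \<otimes> y)
      = (\<Oplus>k\<in>{..n}. [(n choose Suc k)] \<cdot> (x [^] Suc k \<otimes> y [^] (n - k))) \<oplus> ?f (Suc n) 0"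
    (is "?L = ?S \<oplus> _")
  proof -
    let ?g = "\<lambda>k. [(n choose k)] \<cdot> (x [^] k \<otimes> y [^] (Suc n - k))"
    have g: "?g \<in> A \<rightarrow> carrier R" for A using x y by simp
    have "?L = finsum R ?g {..n}"
      by (rule finsum_cong') (use x y in \<open>auto simp: fy Suc_diff_le simp del: nat_pow_Suc\<close>)
    also have "\<dots> = finsum R ?g {..Suc n}"
      using x y g[of "{..n}"] finsum_Suc[OF g, of n] by (simp add: binomial_eq_0)
    also have "\<dots> = (\<Oplus>k\<in>{..n}. ?g (Suc k)) \<oplus> ?g 0"
      by (rule finsum_Suc2[OF g])
    finally show ?thesis by simp
  qed
  have "(x \<oplus> y) [^] Suc n = finsum R (?f n) {..n} \<otimes> x \<oplus> finsum R (?f n) {..n} \<otimes> y"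
    using x y Suc by (simp add: r_distr)
  also have "\<dots> = (\<Oplus>k\<in>{..n}. ?f n k \<otimes> x) \<oplus> (\<Oplus>k\<in>{..n}. ?f n k \<otimes> y)"
    using x y cl by (simp add: finsum_ldistr)
  also have "\<dots> = (\<Oplus>k\<in>{..n}. ?f (Suc n) (Suc k)) \<oplus> ?f (Suc n) 0"
    unfolding step sy using x y cl by (subst finsum_addf) (auto simp: a_assoc simp del: nat_pow_Suc)
  also have "\<dots> = finsum R (?f (Suc n)) {..Suc n}"
    by (rule finsum_Suc2[symmetric]) (use cl in auto)
  finally show ?case .
qed

lemma frobenius_add:
  assumes p: "Factorial_Ring.prime (p::nat)" and char: "\<And>z. z \<in> carrier R \<Longrightarrow> [p] \<cdot> z = \<zero>"
    and x: "x \<in> carrier R" and y: "y \<in> carrier R" and xy: "x \<otimes> y = y \<otimes> x"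
  shows "(x \<oplus> y) [^] p = x [^] p \<oplus> y [^] p"
proof -
  let ?f = "\<lambda>k. [(p choose k)] \<cdot> (x [^] k \<otimes> y [^] (p - k))"
  \<comment> \<open>With p = m + 2 both extreme terms can be split off; the indices 1 to m + 1
    remain, where p divides the binomial coefficient.\<close>
  obtain m where m: "p = Suc (Suc m)"
    using prime_ge_2_nat[OF p] by (metis add_2_eq_Suc le_Suc_ex)
  have f: "?f \<in> A \<rightarrow> carrier R" for A using x y by simp
  have "?f (Suc k) = \<zero>" if "k \<in> {..m}" for k
  proof -
    have "p dvd (p choose Suc k)"
      using that m by (intro dvd_choose_prime p) auto
    then obtain c where "p choose Suc k = p * c" by (rule dvdE)
    moreover have "[(p * c)] \<cdot> z = \<zero>" if "z \<in> carrier R" for z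
      using that char[of "[c] \<cdot> z"] by (simp add: add.nat_pow_pow mult.commute)
    ultimately show ?thesis using x y by simp
  qed
  then have z: "(\<Oplus>k\<in>{..m}. ?f (Suc k)) = \<zero>"
    by (rule add.finprod_one_eqI)
  have "(x \<oplus> y) [^] p = finsum R ?f {..p}"
    by (rule binomial_commuting[OF x y xy])
  also have "\<dots> = ?f p \<oplus> ((\<Oplus>k\<in>{..m}. ?f (Suc k)) \<oplus> ?f 0)"
    using finsum_Suc[OF f, of "Suc m"] finsum_Suc2[OF f, of m] unfolding m by metis
  also have "\<dots> = x [^] p \<oplus> y [^] p"
    unfolding z using x y by simp
  finally show ?thesis .
qed

lemma frobenius_finsum:
  assumes p: "Factorial_Ring.prime (p::nat)" and char: "\<And>z. z \<in> carrier R \<Longrightarrow> [p] \<cdot> z = \<zero>"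
    and "finite A" and x: "\<And>k. k \<in> A \<Longrightarrow> x k \<in> carrier R"
    and comm: "\<And>k l. \<lbrakk>k \<in> A; l \<in> A\<rbrakk> \<Longrightarrow> x k \<otimes> x l = x l \<otimes> x k"
  shows "(\<Oplus>k\<in>A. x k) [^] p = (\<Oplus>k\<in>A. x k [^] p)"
  using assms(3-)
proof (induction A rule: finite_induct)
  case empty
  then show ?case
    using p by (simp add: nat_pow_zero prime_gt_0_nat)
next
  case (insert a A)
  have xA: "x \<in> A \<rightarrow> carrier R" using insert.prems by auto
  \<comment> \<open>The new summand commutes with each old one, hence by distributivity with their
    sum, as the two-term case requires.\<close>
  have "x a \<otimes> (\<Oplus>k\<in>A. x k) = (\<Oplus>k\<in>A. x a \<otimes> x k)"
    using insert xA by (intro finsum_rdistr) auto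
  also have "\<dots> = (\<Oplus>k\<in>A. x k \<otimes> x a)"
    using insert.prems by (intro finsum_cong') auto
  also have "\<dots> = (\<Oplus>k\<in>A. x k) \<otimes> x a"
    using insert xA by (intro finsum_ldistr[symmetric]) auto
  finally have "(x a \<oplus> (\<Oplus>k\<in>A. x k)) [^] p = x a [^] p \<oplus> (\<Oplus>k\<in>A. x k) [^] p"
    using insert xA by (intro frobenius_add p char) auto
  then show ?case
    using insert xA by (simp add: Pi_def)
qed

lemma frobenius_power_finsum:
  assumes p: "Factorial_Ring.prime (p::nat)" and char: "\<And>z. z \<in> carrier R \<Longrightarrow> [p] \<cdot> z = \<zero>"
    and "finite A" and x: "\<And>k. k \<in> A \<Longrightarrow> x k \<in> carrier R"
    and comm: "\<And>k l. \<lbrakk>k \<in> A; l \<in> A\<rbrakk> \<Longrightarrow> x k \<otimes> x l = x l \<otimes> x k"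
  shows "(\<Oplus>k\<in>A. x k) [^] (p ^ j) = (\<Oplus>k\<in>A. x k [^] (p ^ j))"
proof (induction j)
  case 0
  have "finsum R x A \<in> carrier R" using x by auto
  then show ?case using x by (auto intro!: finsum_cong')
next
  case (Suc j)
  have S: "finsum R x A \<in> carrier R" using x by auto
  \<comment> \<open>Commutation passes to powers, so the induction hypothesis can be followed by one
    more application of the Frobenius map.\<close>
  have c: "x k [^] m \<otimes> x l [^] m = x l [^] m \<otimes> x k [^] m" if "k \<in> A" "l \<in> A" for k l and m :: nat
    using that x comm group_commutes_pow
    by (metis nat_pow_closed)
  have "finsum R x A [^] (p ^ Suc j) = (finsum R x A [^] (p ^ j)) [^] p"
    using S by (simp add: nat_pow_pow mult.commute)
  also have "\<dots> = (\<Oplus>k\<in>A. (x k [^] (p ^ j)) [^] p)"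
    unfolding Suc by (rule frobenius_finsum[OF p char assms(3)]) (use x c in auto)
  also have "\<dots> = (\<Oplus>k\<in>A. x k [^] (p ^ Suc j))"
    using x by (intro finsum_cong') (auto simp: nat_pow_pow mult.commute)
  finally show ?case .
qed

end

text \<open>Operations on cosets are defined as unions over all representatives; once the result is
  the same for all of them, the union collapses to that single value.\<close>

lemma UN_UN_const:
  assumes "a \<in> A" "b \<in> B" "\<And>x y. \<lbrakk>x \<in> A; y \<in> B\<rbrakk> \<Longrightarrow> f x y = C"
  shows "(\<Union>x\<in>A. \<Union>y\<in>B. f x y) = C"
  using assms by blast

section \<open>Finitely supported functions as sums of single terms\<close>

lemma poly_mapping_sum_single:
  fixes f :: "'a \<Rightarrow>\<^sub>0 'b::comm_monoid_add"
  shows "f = (\<Sum>k\<in>Poly_Mapping.keys f. Poly_Mapping.single k (Poly_Mapping.lookup f k))"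
proof (rule poly_mapping_eqI)
  fix k
  have "(\<Sum>l\<in>Poly_Mapping.keys f. if l = k then Poly_Mapping.lookup f l else 0)
      = Poly_Mapping.lookup f k"
    by (subst sum.delta) (auto simp: in_keys_iff)
  then show "Poly_Mapping.lookup f k =
      Poly_Mapping.lookup (\<Sum>k\<in>Poly_Mapping.keys f. Poly_Mapping.single k (Poly_Mapping.lookup f k)) k"
    by (simp add: lookup_sum lookup_single when_def)
qed

text \<open>The last case concerns only keys of the given \<open>f\<close> with their own
  coefficients, so that a condition on the support of \<open>f\<close> is still available
  there.\<close>

lemma poly_mapping_additive_induct:
  fixes f :: "'a \<Rightarrow>\<^sub>0 'b::comm_monoid_add"
  assumes "P 0" and "\<And>f g. P f \<Longrightarrow> P g \<Longrightarrow> P (f + g)"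
    and "\<And>k. k \<in> Poly_Mapping.keys f \<Longrightarrow> P (Poly_Mapping.single k (Poly_Mapping.lookup f k))"
  shows "P f"
proof -
  have "P (\<Sum>k\<in>K. Poly_Mapping.single k (Poly_Mapping.lookup f k))"
    if "finite K" "K \<subseteq> Poly_Mapping.keys f" for K
    using that by (induction K) (auto intro: assms)
  from this[OF finite_keys order_refl] show ?thesis
    by (simp flip: poly_mapping_sum_single)
qed

lemma ring_hom_nat_pow:
  assumes "h \<in> Ring.ring_hom R S" "Group.monoid R" "x \<in> carrier R"
  shows "h (x [^]\<^bsub>R\<^esub> (k::nat)) = h x [^]\<^bsub>S\<^esub> k"
  using assms(3)
  by (induction k)
    (simp_all add: ring_hom_one[OF assms(1)] ring_hom_mult[OF assms(1)] monoid.nat_pow_closed[OF assms(2)])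

section \<open>The algebra and its parity grading\<close>

lemma free_alg_simps [simp]:
  "f \<in> carrier (free_alg n) \<longleftrightarrow> (\<forall>w\<in>Poly_Mapping.keys f. set (letters w) \<subseteq> gens n)"
  "\<one>\<^bsub>free_alg n\<^esub> = 1" "\<zero>\<^bsub>free_alg n\<^esub> = 0"
  "f \<otimes>\<^bsub>free_alg n\<^esub> g = f * g" "f \<oplus>\<^bsub>free_alg n\<^esub> g = f + g"
  by (simp_all add: free_alg_def)

lemma letters_plus [simp]: "letters (u + v) = letters u @ letters v"
  by (simp add: plus_gword_def)

lemma letters_zero [simp]: "letters 0 = []"
  by (simp add: zero_gword_def)

lemma free_alg_add_closed:
  "\<lbrakk>f \<in> carrier (free_alg n); g \<in> carrier (free_alg n)\<rbrakk> \<Longrightarrow> f + g \<in> carrier (free_alg n)"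
  using keys_add[of f g] by auto

lemma free_alg_mult_closed:
  "\<lbrakk>f \<in> carrier (free_alg n); g \<in> carrier (free_alg n)\<rbrakk> \<Longrightarrow> f * g \<in> carrier (free_alg n)"
  using keys_mult[of f g] by fastforce

lemma free_alg_uminus_closed:
  "f \<in> carrier (free_alg n) \<Longrightarrow> - f \<in> carrier (free_alg n)"
  by (auto simp: in_keys_iff)

lemma free_alg_ring: "ring (free_alg n)"
proof (rule ringI)
  show "abelian_group (free_alg n)"
  proof (rule abelian_groupI)
    fix f :: "'p::prime_card free_elt"
    assume "f \<in> carrier (free_alg n)"
    then show "\<exists>g\<in>carrier (free_alg n). g \<oplus>\<^bsub>free_alg n\<^esub> f = \<zero>\<^bsub>free_alg n\<^esub>"
      by (intro bexI[of _ "- f"] free_alg_uminus_closed) simp_all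
  next
    fix f g :: "'p::prime_card free_elt"
    assume "f \<in> carrier (free_alg n)" "g \<in> carrier (free_alg n)"
    then show "f \<oplus>\<^bsub>free_alg n\<^esub> g \<in> carrier (free_alg n)"
      using free_alg_add_closed by (metis free_alg_simps(5))
  qed (simp_all add: algebra_simps)
  show "Group.monoid (free_alg n)"
  proof (rule monoidI)
    fix f g :: "'p::prime_card free_elt"
    assume "f \<in> carrier (free_alg n)" "g \<in> carrier (free_alg n)"
    then show "f \<otimes>\<^bsub>free_alg n\<^esub> g \<in> carrier (free_alg n)"
      using free_alg_mult_closed by (metis free_alg_simps(4))
  qed (simp_all add: algebra_simps)
qed (simp_all add: algebra_simps)

lemma free_alg_a_inv:
  assumes "f \<in> carrier (free_alg n)"
  shows "\<ominus>\<^bsub>free_alg n\<^esub> f = - f"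
proof -
  interpret ring "free_alg n" by (rule free_alg_ring)
  show ?thesis
    using assms free_alg_uminus_closed[OF assms]
    by (intro minus_equality) auto
qed

section \<open>Parity grading of the free algebra\<close>

definition free_homog :: "nat \<Rightarrow> 'p::prime_card free_elt \<Rightarrow> bool" where
  "free_homog s f \<longleftrightarrow> (\<forall>w\<in>Poly_Mapping.keys f. word_degree CARD('p) w mod 2 = s)"

lemma lookup_free_part:
  fixes f :: "'p::prime_card free_elt"
  shows "Poly_Mapping.lookup (free_part s f) w =
    (if word_degree CARD('p) w mod 2 = s then Poly_Mapping.lookup f w else 0)"
proof -
  have "Poly_Mapping.lookup (free_part s f) w =
     (\<Sum>v | v \<in> Poly_Mapping.keys f \<and> word_degree CARD('p) v mod 2 = s.
        if v = w then Poly_Mapping.lookup f v else 0)"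
    unfolding free_part_def lookup_sum by (rule sum.cong) (auto simp: lookup_single when_def)
  also have "\<dots> = (if word_degree CARD('p) w mod 2 = s then Poly_Mapping.lookup f w else 0)"
    by (subst sum.delta) (auto simp: in_keys_iff)
  finally show ?thesis .
qed

lemma free_part_add: "free_part s (f + g) = free_part s f + free_part s g"
  by (rule poly_mapping_eqI) (simp add: lookup_free_part lookup_add)

lemma free_part_uminus: "free_part s (- f) = - free_part s f"
  by (rule poly_mapping_eqI) (simp add: lookup_free_part)

lemma free_part_diff: "free_part s (f - g) = free_part s f - free_part s g"
  by (rule poly_mapping_eqI) (simp add: lookup_free_part lookup_minus)

lemma free_part_zero [simp]: "free_part s 0 = 0"
  by (rule poly_mapping_eqI) (simp add: lookup_free_part)

lemma free_part_homog: "free_homog s f \<Longrightarrow> free_part t f = (if t = s then f else 0)"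
  by (rule poly_mapping_eqI) (auto simp: lookup_free_part free_homog_def in_keys_iff)

lemma free_homog_part: "free_homog s (free_part s f)"
  by (auto simp: free_homog_def in_keys_iff lookup_free_part split: if_splits)

lemma free_part_decomp: "f = free_part 0 f + free_part 1 f"
  by (rule poly_mapping_eqI) (auto simp: lookup_free_part lookup_add)

lemma free_part_closed: "f \<in> carrier (free_alg n) \<Longrightarrow> free_part s f \<in> carrier (free_alg n)"
  by (auto simp: in_keys_iff lookup_free_part split: if_splits)

lemma word_degree_plus: "word_degree p (u + v) = word_degree p u + word_degree p v"
  by (simp add: word_degree_def)

lemma free_homog_mult:
  fixes f g :: "'p::prime_card free_elt"
  assumes "free_homog s f" "free_homog t g"
  shows "free_homog ((s + t) mod 2) (f * g)"
  unfolding free_homog_def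
proof
  fix w assume "w \<in> Poly_Mapping.keys (f * g)"
  then obtain u v where "w = u + v" "u \<in> Poly_Mapping.keys f" "v \<in> Poly_Mapping.keys g"
    using keys_mult[of f g] by blast
  then show "word_degree CARD('p) w mod 2 = (s + t) mod 2"
    using assms by (simp add: free_homog_def word_degree_plus) (metis mod_add_eq)
qed

lemma free_homog_add: "\<lbrakk>free_homog s f; free_homog s g\<rbrakk> \<Longrightarrow> free_homog s (f + g)"
  using keys_add[of f g] by (auto simp: free_homog_def)

lemma free_homog_uminus: "free_homog s f \<Longrightarrow> free_homog s (- f)"
  by (auto simp: free_homog_def in_keys_iff)

lemma free_homog_diff: "\<lbrakk>free_homog s f; free_homog s g\<rbrakk> \<Longrightarrow> free_homog s (f - g)"
  using free_homog_add[of s f "- g"] free_homog_uminus[of s g] by simp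

lemma free_homog_one: "free_homog 0 1"
  by (simp add: free_homog_def word_degree_def)

lemma free_homog_const: "free_homog 0 (Poly_Mapping.single 0 c)"
  by (simp add: free_homog_def word_degree_def)

lemma free_homog_pow: "free_homog 0 f \<Longrightarrow> free_homog 0 (f ^ k)"
  by (induction k) (use free_homog_one free_homog_mult[of 0 _ 0] in auto)

lemma free_homog_var:
  "free_homog (case g of Xi i \<Rightarrow> 0 | Tau i \<Rightarrow> 1) (var g :: 'p::prime_card free_elt)"
proof -
  \<comment> \<open>The subtraction is truncated: 2c - 1 is odd only for positive c, here a power of
    the prime.\<close>
  have "(2 * c - Suc 0) mod 2 = Suc 0" if "c > 0" for c :: nat
    using that by presburger
  then show ?thesis
    by (auto simp: free_homog_def var_def word_degree_def split: gen.splits)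
qed

text \<open>Parities add modulo 2, so two of the four products of parts have parity
  \<open>s\<close>; for \<open>s\<close> in {0, 1} the term \<open>1 - s\<close> is the opposite
  parity.\<close>

lemma free_part_mult:
  assumes "s \<in> {0, 1}"
  shows "free_part s (f * g) = free_part 0 f * free_part s g + free_part 1 f * free_part (1 - s) g"
proof -
  have "f * g = (free_part 0 f + free_part 1 f) * (free_part 0 g + free_part 1 g)"
    using free_part_decomp[of f] free_part_decomp[of g] by simp
  also have "\<dots> = free_part 0 f * free_part 0 g + free_part 0 f * free_part 1 g
      + free_part 1 f * free_part 0 g + free_part 1 f * free_part 1 g"
    by (simp add: algebra_simps)
  finally have "free_part s (f * g) = free_part s (free_part 0 f * free_part 0 g)
      + free_part s (free_part 0 f * free_part 1 g)
      + free_part s (free_part 1 f * free_part 0 g) + free_part s (free_part 1 f * free_part 1 g)"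
    by (simp add: free_part_add)
  moreover have "free_part s (free_part t f * free_part u g) =
      (if s = (t + u) mod 2 then free_part t f * free_part u g else 0)" for t u
    by (rule free_part_homog[OF free_homog_mult[OF free_homog_part free_homog_part]])
  ultimately show ?thesis using assms by auto
qed

section \<open>The defining relations and the ideal that they generate\<close>

lemma var_closed: "g \<in> gens n \<Longrightarrow> var g \<in> carrier (free_alg n)"
  by (simp add: var_def)

lemma free_alg_pow_closed: "f \<in> carrier (free_alg n) \<Longrightarrow> f ^ k \<in> carrier (free_alg n)"
proof (induction k)
  case (Suc k)
  then show ?case using free_alg_mult_closed by (metis power_Suc)
qed simp

lemma free_alg_diff_closed:
  "\<lbrakk>f \<in> carrier (free_alg n); g \<in> carrier (free_alg n)\<rbrakk> \<Longrightarrow> f - g \<in> carrier (free_alg n)"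
  using free_alg_add_closed[of f n "- g"] free_alg_uminus_closed[of g n] by (metis add_uminus_conv_diff)

lemma dsa_relations_closed: "dsa_relations n \<subseteq> carrier (free_alg n)"
proof -
  have xi: "var (Xi i) \<in> carrier (free_alg n)" if "i \<in> {1..n}" for i
    using that by (intro var_closed) (auto simp: gens_def)
  have tau: "var (Tau i) \<in> carrier (free_alg n)" if "i \<le> n" for i
    using that by (intro var_closed) (auto simp: gens_def)
  show ?thesis
    unfolding dsa_relations_def
    by (intro Un_least subsetI; elim CollectE exE conjE; hypsubst)
      (intro free_alg_diff_closed free_alg_add_closed free_alg_mult_closed free_alg_pow_closed
        xi tau var_closed; assumption)+
qed

text \<open>Every \<xi> is even, so both terms of a commutator with it have the parity of the other
  factor; the relations of the remaining three families are even.\<close>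

lemma dsa_relations_homog:
  fixes r :: "'p::prime_card free_elt"
  assumes "r \<in> dsa_relations n"
  shows "\<exists>s. free_homog s r"
proof -
  note v = free_homog_var[of "Xi _", simplified] free_homog_var[of "Tau _", simplified] free_homog_var
  show ?thesis
    using assms unfolding dsa_relations_def
  proof (elim UnE CollectE exE conjE; hypsubst)
    fix i g
    let ?s = "(case g of Xi i \<Rightarrow> 0 | Tau i \<Rightarrow> 1) :: nat"
    have "free_homog (?s mod 2) (var (Xi i) * var g - var g * var (Xi i) :: 'p free_elt)"
      using free_homog_mult[OF v(1)[of i] v(3)[of g]] free_homog_mult[OF v(3)[of g] v(1)[of i]]
      by (intro free_homog_diff) (simp_all split: gen.splits)
    then show "\<exists>s. free_homog s (var (Xi i) * var g - var g * var (Xi i) :: 'p free_elt)" ..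
  next
    fix i j
    have "free_homog 0 (var (Tau i) * var (Tau j) + var (Tau j) * var (Tau i) :: 'p free_elt)"
      using free_homog_mult[OF v(2)[of i] v(2)[of j]] free_homog_mult[OF v(2)[of j] v(2)[of i]]
      by (intro free_homog_add) (simp_all add: numeral_2_eq_2)
    then show "\<exists>s. free_homog s (var (Tau i) * var (Tau j) + var (Tau j) * var (Tau i) :: 'p free_elt)" ..
  next
    fix i
    show "\<exists>s. free_homog s (var (Xi i) ^ CARD('p) ^ (n + 1 - i) :: 'p free_elt)"
      using free_homog_pow[OF v(1)] by blast
  next
    fix i
    show "\<exists>s. free_homog s ((var (Tau i))\<^sup>2 :: 'p free_elt)"
      using free_homog_mult[OF v(2)[of i] v(2)[of i]] by (auto simp: power2_eq_square)
  qed
qed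

lemma dsa_ideal: "ideal (dsa_ideal n) (free_alg n)"
  unfolding dsa_ideal_def by (rule ring.genideal_ideal[OF free_alg_ring dsa_relations_closed])

lemma dsa_ideal_closed:
  "f \<in> dsa_ideal n \<Longrightarrow> f \<in> carrier (free_alg n)"
  using additive_subgroup.a_Hcarr[OF ideal.axioms(1)[OF dsa_ideal]] by blast

lemma dsa_ideal_add: "\<lbrakk>f \<in> dsa_ideal n; g \<in> dsa_ideal n\<rbrakk> \<Longrightarrow> f + g \<in> dsa_ideal n"
  using additive_subgroup.a_closed[OF ideal.axioms(1)[OF dsa_ideal]] by fastforce

lemma dsa_ideal_zero: "0 \<in> dsa_ideal n"
  using additive_subgroup.zero_closed[OF ideal.axioms(1)[OF dsa_ideal]] by fastforce

lemma dsa_ideal_uminus: "f \<in> dsa_ideal n \<Longrightarrow> - f \<in> dsa_ideal n"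
  using additive_subgroup.a_inv_closed[OF ideal.axioms(1)[OF dsa_ideal]] free_alg_a_inv dsa_ideal_closed
  by metis

lemma dsa_ideal_lmult: "\<lbrakk>f \<in> dsa_ideal n; g \<in> carrier (free_alg n)\<rbrakk> \<Longrightarrow> g * f \<in> dsa_ideal n"
  using ideal.I_l_closed[OF dsa_ideal] by (metis free_alg_simps(4))

lemma dsa_ideal_rmult: "\<lbrakk>f \<in> dsa_ideal n; g \<in> carrier (free_alg n)\<rbrakk> \<Longrightarrow> f * g \<in> dsa_ideal n"
  using ideal.I_r_closed[OF dsa_ideal] by (metis free_alg_simps(4))

lemma dsa_relations_ideal: "dsa_relations n \<subseteq> dsa_ideal n"
  unfolding dsa_ideal_def by (rule ring.genideal_self[OF free_alg_ring dsa_relations_closed])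

text \<open>An ideal with homogeneous generators contains the parts of its elements. This is what
  makes the parity projections of the quotient independent of representatives.\<close>

lemma free_part_dsa_ideal:
  fixes f :: "'p::prime_card free_elt"
  assumes "f \<in> dsa_ideal n" and s: "s \<in> {0, 1}"
  shows "free_part s f \<in> dsa_ideal n"
proof -
  \<comment> \<open>The generated ideal is the least one containing the relations, so it suffices
    that the elements with both parts in it form an ideal containing the relations.\<close>
  let ?J = "{f :: 'p free_elt. f \<in> carrier (free_alg n) \<and> ( \<forall>s\<in>{0, 1}. free_part s f \<in> dsa_ideal n)}"
  note cl = free_alg_add_closed free_alg_uminus_closed free_alg_mult_closed free_part_closed
    dsa_ideal_add dsa_ideal_uminus dsa_ideal_zero dsa_ideal_lmult dsa_ideal_rmult
  have addsub: "additive_subgroup ?J (free_alg n)"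
  proof (intro additive_subgroup.intro)
    interpret ring "free_alg n :: 'p free_elt ring" by (rule free_alg_ring)
    show "subgroup ?J (add_monoid (free_alg n))"
    proof (rule add.subgroupI)
      show "?J \<noteq> {}"
        using dsa_ideal_zero[of n] by (intro ex_in_conv[THEN iffD1] exI[of _ 0]) simp
    next
      fix a assume a: "a \<in> ?J"
      then have "\<ominus>\<^bsub>free_alg n\<^esub> a = - a" by (intro free_alg_a_inv) blast
      with a show "\<ominus>\<^bsub>free_alg n\<^esub> a \<in> ?J"
        using cl(2)[of a n] by (auto simp: free_part_uminus cl(6))
    next
      fix a b assume "a \<in> ?J" "b \<in> ?J"
      then show "a \<oplus>\<^bsub>free_alg n\<^esub> b \<in> ?J"
        using cl(1)[of a n b] by (auto simp: free_part_add cl(5))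
    qed blast
  qed
  have "ideal ?J (free_alg n)"
  proof (rule idealI[OF free_alg_ring])
    show "subgroup ?J (add_monoid (free_alg n))"
      by (rule additive_subgroup.a_subgroup[OF addsub])
  next
    fix a x :: "'p free_elt" assume a: "a \<in> ?J" and x: "x \<in> carrier (free_alg n)"
    from a have a': "a \<in> carrier (free_alg n)" "\<And>s. s \<in> {0, 1} \<Longrightarrow> free_part s a \<in> dsa_ideal n"
      by blast+
    have x': "free_part s x \<in> carrier (free_alg n)" for s
      using x by (rule free_part_closed)
    \<comment> \<open>Each of the two summands has a part of \<open>a\<close> as a factor, and these
      parts lie in the ideal.\<close>
    have "free_part s (x * a) \<in> dsa_ideal n" if s: "s \<in> {0, 1}" for s
      unfolding free_part_mult[OF s] using s
      by (intro cl(5) cl(8) a' x') auto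
    moreover have "free_part s (a * x) \<in> dsa_ideal n" if s: "s \<in> {0, 1}" for s
      unfolding free_part_mult[OF s] using s
      by (intro cl(5) cl(9) a' x') auto
    ultimately show "x \<otimes>\<^bsub>free_alg n\<^esub> a \<in> ?J" "a \<otimes>\<^bsub>free_alg n\<^esub> x \<in> ?J"
      using a' x cl(3)[of a n x] cl(3)[of x n a] unfolding free_alg_simps(4) by blast+
  qed
  moreover have "dsa_relations n \<subseteq> ?J"
  proof (intro subsetI CollectI conjI ballI)
    fix r s assume r: "r \<in> dsa_relations n"
    then show "r \<in> carrier (free_alg n)" using dsa_relations_closed by blast
    from dsa_relations_homog[OF r] obtain t where "free_homog t r" ..
    \<comment> \<open>A homogeneous relation has itself and 0 as its only possible parts.\<close>
    then show "free_part s r \<in> dsa_ideal n"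
      using r dsa_relations_ideal dsa_ideal_zero free_part_homog by (metis subsetD)
  qed
  ultimately have "dsa_ideal n \<subseteq> ?J"
    unfolding dsa_ideal_def by (rule ring.genideal_minimal[OF free_alg_ring])
  with assms show ?thesis by blast
qed

section \<open>The quotient ring and its classes\<close>

lemma dsa_ring: "ring (dsa n)"
  unfolding dsa_def by (rule ideal.quotient_is_ring[OF dsa_ideal])

lemma dsa_class_hom: "dsa_class n \<in> Ring.ring_hom (free_alg n) (dsa n)"
proof -
  have "dsa_class n = (+>\<^bsub>free_alg n\<^esub>) (dsa_ideal n)"
    by (rule ext) (simp add: dsa_class_def)
  then show ?thesis
    unfolding dsa_def using ideal.rcos_ring_hom[OF dsa_ideal] by metis
qed

lemma dsa_carrier: "carrier (dsa n) = dsa_class n ` carrier (free_alg n)"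
  unfolding dsa_def FactRing_def dsa_class_def by (auto simp: A_RCOSETS_defs a_r_coset_def)

lemma dsa_class_closed: "f \<in> carrier (free_alg n) \<Longrightarrow> dsa_class n f \<in> carrier (dsa n)"
  unfolding dsa_carrier by (rule imageI)

lemma dsa_class_add:
  "\<lbrakk>f \<in> carrier (free_alg n); g \<in> carrier (free_alg n)\<rbrakk>
    \<Longrightarrow> dsa_class n (f + g) = dsa_class n f \<oplus>\<^bsub>dsa n\<^esub> dsa_class n g"
  using ring_hom_add[OF dsa_class_hom] by (metis free_alg_simps(5))

lemma dsa_class_mult:
  "\<lbrakk>f \<in> carrier (free_alg n); g \<in> carrier (free_alg n)\<rbrakk>
    \<Longrightarrow> dsa_class n (f * g) = dsa_class n f \<otimes>\<^bsub>dsa n\<^esub> dsa_class n g"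
  using ring_hom_mult[OF dsa_class_hom] by (metis free_alg_simps(4))

lemma dsa_class_one: "dsa_class n 1 = \<one>\<^bsub>dsa n\<^esub>"
  using ring_hom_one[OF dsa_class_hom] by (metis free_alg_simps(2))

lemma dsa_class_mem:
  assumes f: "f \<in> carrier (free_alg n)"
  shows "g \<in> dsa_class n f \<longleftrightarrow> g \<in> carrier (free_alg n) \<and> g - f \<in> dsa_ideal n"
proof
  assume "g \<in> dsa_class n f"
  then obtain h where "h \<in> dsa_ideal n" "g = h + f"
    by (auto simp: dsa_class_def a_r_coset_def')
  then show "g \<in> carrier (free_alg n) \<and> g - f \<in> dsa_ideal n"
    using f dsa_ideal_closed free_alg_add_closed by (metis add_diff_cancel_right')
next
  assume "g \<in> carrier (free_alg n) \<and> g - f \<in> dsa_ideal n"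
  then show "g \<in> dsa_class n f"
    by (auto simp: dsa_class_def a_r_coset_def' intro!: bexI[of _ "g - f"])
qed

lemma dsa_class_eqI:
  assumes f: "f \<in> carrier (free_alg n)" and g: "g \<in> carrier (free_alg n)"
    and fg: "f - g \<in> dsa_ideal n"
  shows "dsa_class n f = dsa_class n g"
proof -
  have "h - g \<in> dsa_ideal n \<longleftrightarrow> h - f \<in> dsa_ideal n" for h
    using dsa_ideal_add[OF _ fg, of "h - f"] dsa_ideal_add[OF _ dsa_ideal_uminus[OF fg], of "h - g"]
    by auto
  then show ?thesis
    using dsa_class_mem[OF f] dsa_class_mem[OF g] by blast
qed

lemma dsa_class_self: "f \<in> carrier (free_alg n) \<Longrightarrow> f \<in> dsa_class n f"
  using dsa_ideal_zero by (simp add: dsa_class_mem del: free_alg_simps)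

lemma dsa_class_zero: "dsa_class n 0 = \<zero>\<^bsub>dsa n\<^esub>"
proof -
  interpret ring "dsa n :: 'a dsa_elt ring" by (rule dsa_ring)
  have z: "(0 :: 'a free_elt) \<in> carrier (free_alg n)" by simp
  note c = dsa_class_closed[OF z]
  have "dsa_class n 0 \<oplus>\<^bsub>dsa n\<^esub> dsa_class n 0 = (dsa_class n 0 :: 'a dsa_elt)"
    using dsa_class_add[OF z z] by simp
  then show ?thesis using add.r_cancel_one[OF c c] by simp
qed

text \<open>Two representatives differ by an element of the ideal, and so do their parts; hence all
  members of the union in \<open>dsa_part\<close> coincide.\<close>

lemma dsa_part_class:
  assumes f: "f \<in> carrier (free_alg n)" and s: "s \<in> {0, 1}"
  shows "dsa_part n s (dsa_class n f) = dsa_class n (free_part s f)"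
proof -
  have "dsa_class n (free_part s g) = dsa_class n (free_part s f)" if "g \<in> dsa_class n f" for g
  proof -
    from that have g: "g \<in> carrier (free_alg n)" and gf: "g - f \<in> dsa_ideal n"
      using dsa_class_mem[OF f] by blast+
    show ?thesis
      using free_part_dsa_ideal[OF gf s]
      by (intro dsa_class_eqI free_part_closed f g) (simp add: free_part_diff)
  qed
  then show ?thesis
    unfolding dsa_part_def using dsa_class_self[OF f] by blast
qed

section \<open>Parity components and scalars in the quotient\<close>

definition dsa_homog :: "nat \<Rightarrow> nat \<Rightarrow> 'p::prime_card dsa_elt set" where
  "dsa_homog n s = dsa_class n ` {f. f \<in> carrier (free_alg n) \<and> free_homog s f}"

lemma dsa_homog_closed: "a \<in> dsa_homog n s \<Longrightarrow> a \<in> carrier (dsa n)"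
  unfolding dsa_homog_def using dsa_class_closed by blast

lemma dsa_homog_mult:
  assumes "a \<in> dsa_homog n s" "b \<in> dsa_homog n t"
  shows "a \<otimes>\<^bsub>dsa n\<^esub> b \<in> dsa_homog n ((s + t) mod 2)"
proof -
  from assms obtain f g where
    f: "f \<in> carrier (free_alg n)" "free_homog s f" "a = dsa_class n f" and
    g: "g \<in> carrier (free_alg n)" "free_homog t g" "b = dsa_class n g"
    unfolding dsa_homog_def by blast
  show ?thesis
    unfolding f(3) g(3) dsa_class_mult[OF f(1) g(1), symmetric] dsa_homog_def
    using free_alg_mult_closed[OF f(1) g(1)] free_homog_mult[OF f(2) g(2)] by blast
qed

lemma dsa_homog_one: "\<one>\<^bsub>dsa n\<^esub> \<in> dsa_homog n 0"
  unfolding dsa_homog_def dsa_class_one[symmetric]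
  by (intro imageI) (simp add: free_homog_one)

lemma dsa_homog_pow: "a \<in> dsa_homog n 0 \<Longrightarrow> a [^]\<^bsub>dsa n\<^esub> (k::nat) \<in> dsa_homog n 0"
  using dsa_homog_mult[of _ n 0 a 0] dsa_homog_one by (induction k) auto

lemma dsa_part_homog_eq:
  assumes "a \<in> dsa_homog n s" "t \<in> {0, 1}"
  shows "dsa_part n t a = (if t = s then a else \<zero>\<^bsub>dsa n\<^esub>)"
proof -
  from assms obtain f where
    f: "f \<in> carrier (free_alg n)" "free_homog s f" "a = dsa_class n f"
    unfolding dsa_homog_def by blast
  show ?thesis
    unfolding f(3) dsa_part_class[OF f(1) assms(2)] free_part_homog[OF f(2)]
    by (simp add: dsa_class_zero)
qed

lemma dsa_part_homog:
  assumes "a \<in> carrier (dsa n)" "s \<in> {0, 1}"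
  shows "dsa_part n s a \<in> dsa_homog n s"
proof -
  from assms obtain f where
    f: "f \<in> carrier (free_alg n)" "a = dsa_class n f"
    unfolding dsa_carrier by blast
  show ?thesis
    unfolding f(2) dsa_part_class[OF f(1) assms(2)] dsa_homog_def
    using free_part_closed[OF f(1)] free_homog_part by blast
qed

lemma dsa_part_closed:
  "\<lbrakk>a \<in> carrier (dsa n); s \<in> {0, 1}\<rbrakk> \<Longrightarrow> dsa_part n s a \<in> carrier (dsa n)"
  by (rule dsa_homog_closed[OF dsa_part_homog])

lemma dsa_part_decomp:
  assumes "a \<in> carrier (dsa n)"
  shows "a = dsa_part n 0 a \<oplus>\<^bsub>dsa n\<^esub> dsa_part n 1 a"
proof -
  from assms obtain f where
    f: "f \<in> carrier (free_alg n)" "a = dsa_class n f"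
    unfolding dsa_carrier by blast
  have "dsa_class n f = dsa_class n (free_part 0 f + free_part 1 f)"
    using free_part_decomp[of f] by simp
  also have "\<dots> = dsa_part n 0 a \<oplus>\<^bsub>dsa n\<^esub> dsa_part n 1 a"
    unfolding f(2) using f(1) free_part_closed[OF f(1)]
    by (simp add: dsa_class_add dsa_part_class del: free_alg_simps)
  finally show ?thesis using f(2) by simp
qed

text \<open>Scalars enter as multiples of the empty word, written \<open>0\<close>. It is neutral on
  both sides and the coefficients commute, so scalars are central; this moves them past a left
  factor in \<open>dsa_scale_rmult\<close>.\<close>

lemma const_commutes:
  fixes f :: "'p::prime_card free_elt"
  shows "f * Poly_Mapping.single 0 c = Poly_Mapping.single 0 c * f"
  by (induction f rule: poly_mapping_additive_induct)
    (simp_all add: algebra_simps mult_single)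

lemma const_closed: "Poly_Mapping.single 0 c \<in> carrier (free_alg n)"
  by simp

lemma dsa_scale_class:
  "f \<in> carrier (free_alg n) \<Longrightarrow>
    dsa_scale n c (dsa_class n f) = dsa_class n (Poly_Mapping.single 0 c * f)"
  unfolding dsa_scale_def by (simp add: dsa_class_mult del: free_alg_simps(1) add: const_closed)

lemma dsa_scale_closed: "a \<in> carrier (dsa n) \<Longrightarrow> dsa_scale n c a \<in> carrier (dsa n)"
  unfolding dsa_scale_def
  by (intro monoid.m_closed[OF ring.is_monoid[OF dsa_ring]] dsa_class_closed const_closed)

lemma dsa_scale_homog: "a \<in> dsa_homog n s \<Longrightarrow> dsa_scale n c a \<in> dsa_homog n s"
proof -
  assume "a \<in> dsa_homog n s"
  then obtain f where f: "f \<in> carrier (free_alg n)" "free_homog s f" "a = dsa_class n f"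
    unfolding dsa_homog_def by blast
  \<comment> \<open>Zero is homogeneous for every number \<open>s\<close>, while products have their
    parity reduced modulo 2. A key of a nonzero \<open>f\<close> forces \<open>s < 2\<close>, so the
    reduction changes nothing.\<close>
  have "free_homog s (Poly_Mapping.single 0 c * f)"
  proof (cases "f = 0")
    case True
    then show ?thesis using f(2) by simp
  next
    case False
    then obtain w where "w \<in> Poly_Mapping.keys f"
      by (metis poly_mapping_eqI in_keys_iff lookup_zero)
    then have "s < 2" using f(2) by (auto simp: free_homog_def)
    then show ?thesis using free_homog_mult[OF free_homog_const f(2), of c] by simp
  qed
  then show ?thesis
    unfolding f(3) dsa_scale_class[OF f(1)] dsa_homog_def
    using free_alg_mult_closed[OF const_closed f(1)] by blast
qed

lemma dsa_scale_zero:
  assumes "a \<in> carrier (dsa n)"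
  shows "dsa_scale n 0 a = \<zero>\<^bsub>dsa n\<^esub>"
proof -
  interpret ring "dsa n :: 'a dsa_elt ring" by (rule dsa_ring)
  show ?thesis
    unfolding dsa_scale_def using assms by (simp add: dsa_class_zero)
qed

lemma dsa_scale_one:
  assumes "a \<in> carrier (dsa n)"
  shows "dsa_scale n 1 a = a"
proof -
  interpret ring "dsa n :: 'a dsa_elt ring" by (rule dsa_ring)
  show ?thesis unfolding dsa_scale_def using assms by (simp add: dsa_class_one)
qed

lemma dsa_scale_scale:
  assumes "a \<in> carrier (dsa n)"
  shows "dsa_scale n c (dsa_scale n d a) = dsa_scale n (c * d) a"
proof -
  from assms obtain f where f: "f \<in> carrier (free_alg n)" "a = dsa_class n f"
    unfolding dsa_carrier by blast
  show ?thesis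
    unfolding f(2) dsa_scale_class[OF f(1)] dsa_scale_class[OF free_alg_mult_closed[OF const_closed f(1)]]
    by (simp add: mult_single flip: mult.assoc)
qed

lemma dsa_scale_lmult:
  assumes "a \<in> carrier (dsa n)" "b \<in> carrier (dsa n)"
  shows "dsa_scale n c a \<otimes>\<^bsub>dsa n\<^esub> b = dsa_scale n c (a \<otimes>\<^bsub>dsa n\<^esub> b)"
  unfolding dsa_scale_def
  using assms monoid.m_assoc[OF ring.is_monoid[OF dsa_ring] dsa_class_closed[OF const_closed]] by blast

lemma dsa_scale_rmult:
  assumes "a \<in> carrier (dsa n)" "b \<in> carrier (dsa n)"
  shows "a \<otimes>\<^bsub>dsa n\<^esub> dsa_scale n c b = dsa_scale n c (a \<otimes>\<^bsub>dsa n\<^esub> b)"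
proof -
  from assms obtain f g where
    f: "f \<in> carrier (free_alg n)" "a = dsa_class n f" and
    g: "g \<in> carrier (free_alg n)" "b = dsa_class n g"
    unfolding dsa_carrier by blast
  note [simp del] = free_alg_simps(1)
  note m = free_alg_mult_closed[OF const_closed, OF f(1)] free_alg_mult_closed[OF const_closed, OF g(1)]
    free_alg_mult_closed[OF f(1) g(1)]
  show ?thesis
    unfolding f(2) g(2) using f(1) g(1) m const_commutes[of f c]
    by (simp add: dsa_scale_class flip: dsa_class_mult mult.assoc)
qed

text \<open>This captures the maps that the product applies to a single tensor factor: one-sided
  multiplications, parity projections and their composites.\<close>

definition dsa_linear :: "nat \<Rightarrow> ('p::prime_card dsa_elt \<Rightarrow> 'p dsa_elt) \<Rightarrow> bool" where
  "dsa_linear n h \<longleftrightarrow> h \<in> carrier (dsa n) \<rightarrow> carrier (dsa n)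
    \<and> (\<forall>a\<in>carrier (dsa n). \<forall>b\<in>carrier (dsa n). h (a \<oplus>\<^bsub>dsa n\<^esub> b) = h a \<oplus>\<^bsub>dsa n\<^esub> h b)
    \<and> (\<forall>c. \<forall>a\<in>carrier (dsa n). h (dsa_scale n c a) = dsa_scale n c (h a))"

lemma dsa_linear_comp: "\<lbrakk>dsa_linear n g; dsa_linear n h\<rbrakk> \<Longrightarrow> dsa_linear n (\<lambda>a. g (h a))"
  unfolding dsa_linear_def by (auto simp: Pi_iff)

lemma dsa_linear_part:
  assumes s: "s \<in> {0, 1}"
  shows "dsa_linear n (dsa_part n s :: 'p::prime_card dsa_elt \<Rightarrow> 'p dsa_elt)"
  unfolding dsa_linear_def
proof (intro conjI allI ballI funcsetI)
  fix a b :: "'p dsa_elt" and c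
  assume a: "a \<in> carrier (dsa n)"
  then show "dsa_part n s a \<in> carrier (dsa n)"
    using s by (rule dsa_part_closed)
  from a obtain f where f: "f \<in> carrier (free_alg n)" "a = dsa_class n f"
    unfolding dsa_carrier by blast
  note pf = free_part_closed[OF f(1)]
  \<comment> \<open>A constant has no odd part, so one summand of the product formula
    vanishes.\<close>
  have "free_part s (Poly_Mapping.single 0 c * f) = Poly_Mapping.single 0 c * free_part s f"
    unfolding free_part_mult[OF s] free_part_homog[OF free_homog_const] by simp
  then show "dsa_part n s (dsa_scale n c a) = dsa_scale n c (dsa_part n s a)"
    unfolding f(2) dsa_scale_class[OF f(1)] dsa_part_class[OF f(1) s] dsa_scale_class[OF pf]
    by (simp only: dsa_part_class[OF free_alg_mult_closed[OF const_closed f(1)] s])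
  assume "b \<in> carrier (dsa n)"
  then obtain g where g: "g \<in> carrier (free_alg n)" "b = dsa_class n g"
    unfolding dsa_carrier by blast
  show "dsa_part n s (a \<oplus>\<^bsub>dsa n\<^esub> b) = dsa_part n s a \<oplus>\<^bsub>dsa n\<^esub> dsa_part n s b"
    unfolding f(2) g(2) dsa_class_add[OF f(1) g(1), symmetric] dsa_part_class[OF f(1) s]
      dsa_part_class[OF g(1) s] dsa_part_class[OF free_alg_add_closed[OF f(1) g(1)] s]
      free_part_add
    by (rule dsa_class_add[OF pf free_part_closed[OF g(1)]])
qed

lemma dsa_linear_lmult: "x \<in> carrier (dsa n) \<Longrightarrow> dsa_linear n (\<lambda>a. x \<otimes>\<^bsub>dsa n\<^esub> a)"
  unfolding dsa_linear_def
  by (auto simp: dsa_scale_rmult ring.ring_simprules[OF dsa_ring])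

lemma dsa_linear_rmult: "x \<in> carrier (dsa n) \<Longrightarrow> dsa_linear n (\<lambda>a. a \<otimes>\<^bsub>dsa n\<^esub> x)"
  unfolding dsa_linear_def
  by (auto simp: dsa_scale_lmult ring.ring_simprules[OF dsa_ring])

section \<open>The generators and their commutation\<close>

lemma xi_homog:
  assumes "i \<le> n"
  shows "xi n i \<in> dsa_homog n 0"
proof (cases "i = 0")
  case True
  then show ?thesis by (simp add: xi_def dsa_homog_one)
next
  case False
  then have "var (Xi i) \<in> carrier (free_alg n)"
    using assms by (intro var_closed) (simp add: gens_def)
  then show ?thesis
    using False free_homog_var[of "Xi i"]
    by (auto simp: xi_def dsa_homog_def simp del: free_alg_simps(1))
qed

lemma tau_closed: "i \<le> n \<Longrightarrow> tau n i \<in> carrier (dsa n)"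
  unfolding tau_def by (intro dsa_class_closed var_closed) (simp add: gens_def)

lemma xi_closed: "i \<le> n \<Longrightarrow> xi n i \<in> carrier (dsa n)"
  by (rule dsa_homog_closed[OF xi_homog])

lemma xi_commute:
  assumes "i \<le> n" "j \<le> n"
  shows "xi n i \<otimes>\<^bsub>dsa n\<^esub> xi n j = xi n j \<otimes>\<^bsub>dsa n\<^esub> (xi n i :: 'p::prime_card dsa_elt)"
proof -
  interpret ring "dsa n :: 'p dsa_elt ring" by (rule dsa_ring)
  show ?thesis
  \<comment> \<open>The element with index 0 is the unit and not a generator, so no defining
    relation covers it.\<close>
  proof (cases "i = 0 \<or> j = 0")
    case True
    moreover have "(xi n i :: 'p dsa_elt) \<in> carrier (dsa n)" "(xi n j :: 'p dsa_elt) \<in> carrier (dsa n)"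
      using assms by (auto intro: xi_closed)
    ultimately show ?thesis by (elim disjE) (simp_all add: xi_def)
  next
    case False
    let ?x = "\<lambda>i. var (Xi i) :: 'p free_elt"
    have c: "?x i \<in> carrier (free_alg n)" "?x j \<in> carrier (free_alg n)"
      using assms False by (auto intro!: var_closed simp: gens_def simp del: free_alg_simps)
    have "?x i * ?x j - ?x j * ?x i \<in> dsa_relations n"
      using assms False by (force simp: dsa_relations_def gens_def)
    then have "dsa_class n (?x i * ?x j) = dsa_class n (?x j * ?x i)"
      using dsa_relations_ideal by (intro dsa_class_eqI free_alg_mult_closed c) blast
    then show ?thesis using False c by (simp add: xi_def dsa_class_mult del: free_alg_simps(1))
  qed
qed

section \<open>The graded tensor product\<close>

lemma lookup_pair_scale [simp]:
  "Poly_Mapping.lookup (pair_scale c v) q = c * Poly_Mapping.lookup v q"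
  unfolding pair_scale_def by (simp add: Poly_Mapping.map.rep_eq when_def)

lemma pair_scale_single [simp]:
  "pair_scale c (Poly_Mapping.single q x) = Poly_Mapping.single q (c * x)"
  by (rule poly_mapping_eqI) (simp add: lookup_single when_def)

interpretation pair: Modules.module pair_scale
  by standard (rule poly_mapping_eqI, simp add: lookup_add algebra_simps)+

text \<open>This is the linear map given by the universal property of the free vector space on
  pairs. Writing the product as two nested extensions yields its bilinearity from general
  facts.\<close>

definition pair_extend ::
    "('p dsa_elt \<times> 'p dsa_elt \<Rightarrow> 'p pair_comb) \<Rightarrow> 'p::prime_card pair_comb \<Rightarrow> 'p pair_comb" where
  "pair_extend F v = (\<Sum>q\<in>Poly_Mapping.keys v. pair_scale (Poly_Mapping.lookup v q) (F q))"

text \<open>Cancellation makes the supports of \<open>v\<close>, \<open>w\<close> and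
  \<open>v + w\<close> unrelated in size; a common finite index set allows their sums to be compared
  termwise.\<close>

lemma pair_extend_superset:
  assumes "finite Q" "Poly_Mapping.keys v \<subseteq> Q"
  shows "pair_extend F v = (\<Sum>q\<in>Q. pair_scale (Poly_Mapping.lookup v q) (F q))"
  unfolding pair_extend_def
  by (rule sum.mono_neutral_left) (use assms in \<open>auto simp: in_keys_iff\<close>)

lemma pair_extend_zero [simp]: "pair_extend F 0 = 0"
  by (simp add: pair_extend_def)

lemma pair_extend_single [simp]: "pair_extend F (Poly_Mapping.single q c) = pair_scale c (F q)"
  by (simp add: pair_extend_def)

lemma pair_extend_add: "pair_extend F (v + w) = pair_extend F v + pair_extend F w"
proof -
  let ?Q = "Poly_Mapping.keys v \<union> Poly_Mapping.keys w"
  have "Poly_Mapping.keys (v + w) \<subseteq> ?Q" by (rule keys_add)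
  then show ?thesis
    by (simp add: pair_extend_superset[of ?Q] lookup_add pair.scale_left_distrib sum.distrib)
qed

lemma pair_extend_scale: "pair_extend F (pair_scale c v) = pair_scale c (pair_extend F v)"
proof -
  have "Poly_Mapping.keys (pair_scale c v) \<subseteq> Poly_Mapping.keys v"
    by (auto simp: in_keys_iff)
  then have "pair_extend F (pair_scale c v) =
      (\<Sum>q\<in>Poly_Mapping.keys v. pair_scale (Poly_Mapping.lookup (pair_scale c v) q) (F q))"
    by (rule pair_extend_superset[OF finite_keys])
  then show ?thesis
    unfolding pair_extend_def[of F v] pair.scale_sum_right pair.scale_scale lookup_pair_scale .
qed

lemma pair_extend_uminus: "pair_extend F (- v) = - pair_extend F v"
  using pair_extend_add[of F v "- v"] by (simp add: eq_neg_iff_add_eq_0 add.commute)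

lemma pair_extend_diff: "pair_extend F (v - w) = pair_extend F v - pair_extend F w"
  using pair_extend_add[of F v "- w"] by (simp add: pair_extend_uminus)

lemma pair_extend_sum: "pair_extend (\<lambda>q. \<Sum>i\<in>I. F i q) v = (\<Sum>i\<in>I. pair_extend (F i) v)"
  unfolding pair_extend_def by (subst sum.swap) (simp add: pair.scale_sum_right)

lemma pair_extend_scale_fun:
  "pair_extend (\<lambda>q. pair_scale c (F q)) v = pair_scale c (pair_extend F v)"
  by (simp add: pair_extend_def pair.scale_sum_right mult.commute)

lemma pair_extend_swap:
  "pair_extend (\<lambda>q. pair_extend (F q) w) v = pair_extend (\<lambda>r. pair_extend (\<lambda>q. F q r) v) w"
  unfolding pair_extend_def by (simp add: pair.scale_sum_right, subst sum.swap) (simp add: mult.commute)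

lemma pair_extend_cong:
  "(\<And>q. q \<in> Poly_Mapping.keys v \<Longrightarrow> F q = G q) \<Longrightarrow> pair_extend F v = pair_extend G v"
  by (simp add: pair_extend_def)

section \<open>The product with Koszul signs on formal combinations\<close>

definition pair_prod ::
    "nat \<Rightarrow> 'p dsa_elt \<times> 'p dsa_elt \<Rightarrow> 'p dsa_elt \<times> 'p dsa_elt \<Rightarrow> 'p::prime_card pair_comb" where
  "pair_prod n = (\<lambda>(a, b) (c, d). \<Sum>s\<in>{0, 1}. \<Sum>t\<in>{0, 1}.
     Poly_Mapping.single (a \<otimes>\<^bsub>dsa n\<^esub> dsa_part n t c, dsa_part n s b \<otimes>\<^bsub>dsa n\<^esub> d) ((- 1) ^ (s * t)))"

lemma pair_mult_extend:
  "pair_mult n v w = pair_extend (\<lambda>q. pair_extend (pair_prod n q) w) v"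
proof -
  have "pair_scale x (pair_scale y (pair_prod n q r)) =
    (\<Sum>s\<in>{0, 1}. \<Sum>t\<in>{0, 1}.
       Poly_Mapping.single
         (fst q \<otimes>\<^bsub>dsa n\<^esub> dsa_part n t (fst r), dsa_part n s (snd q) \<otimes>\<^bsub>dsa n\<^esub> snd r)
         ((- 1) ^ (s * t) * x * y))" for q r :: "'a dsa_elt \<times> 'a dsa_elt" and x y
    by (simp add: pair_prod_def split_beta pair.scale_sum_right pair.scale_right_distrib mult_ac)
  then show ?thesis
    by (simp only: pair_mult_def pair_extend_def pair.scale_sum_right case_prod_unfold prod.collapse)
qed

lemma pair_mult_add_left: "pair_mult n (u + v) w = pair_mult n u w + pair_mult n v w"
  by (simp add: pair_mult_extend pair_extend_add)

text \<open>With the extension over \<open>w\<close> outermost, linearity in the second argument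
  becomes visible, as \<open>pair_mult_extend\<close> shows it for the first.\<close>

lemma pair_mult_swap:
  "pair_mult n v w = pair_extend (\<lambda>r. pair_extend (\<lambda>q. pair_prod n q r) v) w"
  unfolding pair_mult_extend by (rule pair_extend_swap)

lemma pair_mult_add_right: "pair_mult n u (v + w) = pair_mult n u v + pair_mult n u w"
  by (simp add: pair_mult_swap pair_extend_add)

lemma pair_mult_diff_left: "pair_mult n (u - v) w = pair_mult n u w - pair_mult n v w"
  by (simp add: pair_mult_extend pair_extend_diff)

lemma pair_mult_diff_right: "pair_mult n u (v - w) = pair_mult n u v - pair_mult n u w"
  by (simp add: pair_mult_swap pair_extend_diff)

lemma pair_mult_single:
  "pair_mult n (Poly_Mapping.single q 1) (Poly_Mapping.single r 1) = pair_prod n q r"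
  by (simp add: pair_mult_extend)

lemma pair_space_subspace: "pair.subspace (pair_space n)"
  unfolding pair.subspace_def pair_space_def
proof (intro conjI allI ballI CollectI)
  fix v w :: "'a pair_comb"
  assume "v \<in> {v. Poly_Mapping.keys v \<subseteq> carrier (dsa n) \<times> carrier (dsa n)}"
    "w \<in> {v. Poly_Mapping.keys v \<subseteq> carrier (dsa n) \<times> carrier (dsa n)}"
  then show "Poly_Mapping.keys (v + w) \<subseteq> carrier (dsa n) \<times> carrier (dsa n)"
    using keys_add[of v w] by blast
next
  fix v :: "'a pair_comb" and c
  assume "v \<in> {v. Poly_Mapping.keys v \<subseteq> carrier (dsa n) \<times> carrier (dsa n)}"
  moreover have "Poly_Mapping.keys (pair_scale c v) \<subseteq> Poly_Mapping.keys v"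
    by (auto simp: in_keys_iff)
  ultimately show "Poly_Mapping.keys (pair_scale c v) \<subseteq> carrier (dsa n) \<times> carrier (dsa n)"
    by blast
qed simp

lemma single_pair_space:
  "\<lbrakk>a \<in> carrier (dsa n); b \<in> carrier (dsa n)\<rbrakk> \<Longrightarrow> Poly_Mapping.single (a, b) c \<in> pair_space n"
  by (simp add: pair_space_def)

lemma pair_mult_closed:
  fixes v w :: "'p::prime_card pair_comb"
  assumes "v \<in> pair_space n" "w \<in> pair_space n"
  shows "pair_mult n v w \<in> pair_space n"
proof -
  interpret ring "dsa n :: 'p dsa_elt ring" by (rule dsa_ring)
  have "pair_prod n q r \<in> pair_space n"
    if "q \<in> Poly_Mapping.keys v" "r \<in> Poly_Mapping.keys w" for q r
  proof -
    from that assms obtain a b c d where "q = (a, b)" "r = (c, d)"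
      "a \<in> carrier (dsa n)" "b \<in> carrier (dsa n)" "c \<in> carrier (dsa n)" "d \<in> carrier (dsa n)"
      by (cases q; cases r) (auto simp: pair_space_def)
    then show ?thesis
      unfolding pair_prod_def
      by (simp only: prod.case)
        (intro pair.subspace_sum[OF pair_space_subspace] single_pair_space m_closed dsa_part_closed)
  qed
  then show ?thesis
    unfolding pair_mult_extend pair_extend_def
    by (intro pair.subspace_sum[OF pair_space_subspace] pair.subspace_scale[OF pair_space_subspace])
qed

section \<open>Stability of the bilinear relations under the product\<close>

lemma bilinear_relationsE:
  assumes "r \<in> bilinear_relations n"
  obtains
    (add_left) a a' b where "a \<in> carrier (dsa n)" "a' \<in> carrier (dsa n)" "b \<in> carrier (dsa n)"
      "r = Poly_Mapping.single (a \<oplus>\<^bsub>dsa n\<^esub> a', b) 1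
         - Poly_Mapping.single (a, b) 1 - Poly_Mapping.single (a', b) 1"
  | (add_right) a b b' where "a \<in> carrier (dsa n)" "b \<in> carrier (dsa n)" "b' \<in> carrier (dsa n)"
      "r = Poly_Mapping.single (a, b \<oplus>\<^bsub>dsa n\<^esub> b') 1
         - Poly_Mapping.single (a, b) 1 - Poly_Mapping.single (a, b') 1"
  | (scale_left) c a b where "a \<in> carrier (dsa n)" "b \<in> carrier (dsa n)"
      "r = Poly_Mapping.single (dsa_scale n c a, b) 1 - Poly_Mapping.single (a, b) c"
  | (scale_right) c a b where "a \<in> carrier (dsa n)" "b \<in> carrier (dsa n)"
      "r = Poly_Mapping.single (a, dsa_scale n c b) 1 - Poly_Mapping.single (a, b) c"
  using assms unfolding bilinear_relations_def
  by (elim UnE CollectE exE conjE) (rule that; assumption)+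

lemma bilinear_subspace_closed:
  fixes v :: "'p::prime_card pair_comb"
  assumes "v \<in> bilinear_subspace n"
  shows "v \<in> pair_space n"
proof -
  interpret ring "dsa n :: 'p dsa_elt ring" by (rule dsa_ring)
  have "bilinear_relations n \<subseteq> (pair_space n :: 'p pair_comb set)"
    by (rule subsetI, erule bilinear_relationsE)
      (simp_all add: pair.subspace_diff[OF pair_space_subspace] single_pair_space dsa_scale_closed)
  with pair_space_subspace show ?thesis
    using assms pair.span_minimal unfolding bilinear_subspace_def by blast
qed

lemma bilinear_subspace_simps:
  "0 \<in> bilinear_subspace n"
  "\<lbrakk>v \<in> bilinear_subspace n; w \<in> bilinear_subspace n\<rbrakk> \<Longrightarrow> v + w \<in> bilinear_subspace n"
  "\<lbrakk>v \<in> bilinear_subspace n; w \<in> bilinear_subspace n\<rbrakk> \<Longrightarrow> v - w \<in> bilinear_subspace n"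
  "v \<in> bilinear_subspace n \<Longrightarrow> pair_scale c v \<in> bilinear_subspace n"
  "(\<And>i. i \<in> I \<Longrightarrow> f i \<in> bilinear_subspace n) \<Longrightarrow> sum f I \<in> bilinear_subspace n"
  unfolding bilinear_subspace_def
  by (rule pair.span_zero pair.span_add pair.span_diff pair.span_scale pair.span_sum;
      assumption)+

lemma bilinear_relation:
  assumes "a \<in> carrier (dsa n)" "b \<in> carrier (dsa n)"
  shows "a' \<in> carrier (dsa n) \<Longrightarrow> Poly_Mapping.single (a \<oplus>\<^bsub>dsa n\<^esub> a', b) 1
         - Poly_Mapping.single (a, b) 1 - Poly_Mapping.single (a', b) 1 \<in> bilinear_subspace n"
    and "b' \<in> carrier (dsa n) \<Longrightarrow> Poly_Mapping.single (a, b \<oplus>\<^bsub>dsa n\<^esub> b') 1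
         - Poly_Mapping.single (a, b) 1 - Poly_Mapping.single (a, b') 1 \<in> bilinear_subspace n"
    and "Poly_Mapping.single (dsa_scale n c a, b) 1 - Poly_Mapping.single (a, b) c \<in> bilinear_subspace n"
    and "Poly_Mapping.single (a, dsa_scale n c b) 1 - Poly_Mapping.single (a, b) c \<in> bilinear_subspace n"
  unfolding bilinear_subspace_def
  by (rule pair.span_base; use assms in \<open>unfold bilinear_relations_def, blast\<close>)+

text \<open>This is well-definedness of g \<otimes> h. Linear maps carry each bilinear relation to
  one of the same shape, and the combinations sent into the subspace form a subspace, so the whole
  span is preserved.\<close>

lemma pair_extend_linear_bilinear:
  fixes v :: "'p::prime_card pair_comb"
  assumes g: "dsa_linear n g" and h: "dsa_linear n h" and v: "v \<in> bilinear_subspace n"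
  shows "pair_extend (\<lambda>(a, b). Poly_Mapping.single (g a, h b) 1) v \<in> bilinear_subspace n"
proof -
  let ?E = "pair_extend (\<lambda>(a, b). Poly_Mapping.single (g a, h b) 1)"
  have gc: "g a \<in> carrier (dsa n)" "h a \<in> carrier (dsa n)" if "a \<in> carrier (dsa n)" for a
    using that g h by (auto simp: dsa_linear_def)
  have "pair.subspace {v. ?E v \<in> bilinear_subspace n}"
    unfolding pair.subspace_def
    by (simp add: pair_extend_add pair_extend_scale bilinear_subspace_simps)
  moreover have "bilinear_relations n \<subseteq> {v. ?E v \<in> bilinear_subspace n}"
  proof (intro subsetI CollectI)
    fix r :: "'p pair_comb" assume "r \<in> bilinear_relations n"
    then show "?E r \<in> bilinear_subspace n"
    proof (cases rule: bilinear_relationsE)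
      case (add_left a a' b)
      then have "g (a \<oplus>\<^bsub>dsa n\<^esub> a') = g a \<oplus>\<^bsub>dsa n\<^esub> g a'" using g by (auto simp: dsa_linear_def)
      then show ?thesis using add_left gc by (simp add: pair_extend_diff bilinear_relation)
    next
      case (add_right a b b')
      then have "h (b \<oplus>\<^bsub>dsa n\<^esub> b') = h b \<oplus>\<^bsub>dsa n\<^esub> h b'" using h by (auto simp: dsa_linear_def)
      then show ?thesis using add_right gc by (simp add: pair_extend_diff bilinear_relation)
    next
      case (scale_left c a b)
      then have "g (dsa_scale n c a) = dsa_scale n c (g a)" using g by (auto simp: dsa_linear_def)
      then show ?thesis using scale_left gc by (simp add: pair_extend_diff bilinear_relation)
    next
      case (scale_right c a b)
      then have "h (dsa_scale n c b) = dsa_scale n c (h b)" using h by (auto simp: dsa_linear_def)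
      then show ?thesis using scale_right gc by (simp add: pair_extend_diff bilinear_relation)
    qed
  qed
  ultimately have "bilinear_subspace n \<subseteq> {v. ?E v \<in> bilinear_subspace n}"
    using pair.span_minimal unfolding bilinear_subspace_def by blast
  with v show ?thesis by blast
qed

text \<open>After projecting to parts, the sign depends on \<open>s\<close> and \<open>t\<close>
  alone. So with one factor fixed the product is a signed sum of four maps to which
  \<open>pair_extend_linear_bilinear\<close> applies.\<close>

lemma pair_extend_prod:
  "pair_extend (\<lambda>q. pair_prod n q (c, d)) v =
    (\<Sum>s\<in>{0, 1}. \<Sum>t\<in>{0, 1}. pair_scale ((- 1) ^ (s * t)) (pair_extend (\<lambda>(a, b).
      Poly_Mapping.single (a \<otimes>\<^bsub>dsa n\<^esub> dsa_part n t c, dsa_part n s b \<otimes>\<^bsub>dsa n\<^esub> d) 1) v))"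
  "pair_extend (pair_prod n (a, b)) v =
    (\<Sum>s\<in>{0, 1}. \<Sum>t\<in>{0, 1}. pair_scale ((- 1) ^ (s * t)) (pair_extend (\<lambda>(c, d).
      Poly_Mapping.single (a \<otimes>\<^bsub>dsa n\<^esub> dsa_part n t c, dsa_part n s b \<otimes>\<^bsub>dsa n\<^esub> d) 1) v))"
  unfolding pair_extend_scale_fun[symmetric] pair_extend_sum[symmetric]
  by (rule pair_extend_cong; simp add: pair_prod_def single_uminus split: prod.splits)+

text \<open>By linearity in \<open>w\<close> only products with a single pair matter, and for those
  the two maps on the factors are linear. Together with the companion for the other side this makes
  the product of classes well defined.\<close>

lemma pair_mult_bilinear_left:
  assumes v: "v \<in> bilinear_subspace n" and w: "w \<in> pair_space n"
  shows "pair_mult n v w \<in> bilinear_subspace n"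
proof -
  have "pair_extend (\<lambda>q. pair_prod n q (c, d)) v \<in> bilinear_subspace n"
    if "(c, d) \<in> Poly_Mapping.keys w" for c d
  proof -
    have cd: "c \<in> carrier (dsa n)" "d \<in> carrier (dsa n)"
      using that w by (auto simp: pair_space_def)
    show ?thesis
      unfolding pair_extend_prod
      by (intro bilinear_subspace_simps pair_extend_linear_bilinear[OF _ _ v] dsa_linear_rmult
          dsa_linear_comp[OF dsa_linear_rmult dsa_linear_part] dsa_part_closed cd)
  qed
  then show ?thesis
    unfolding pair_mult_swap
    by (subst pair_extend_def) (intro bilinear_subspace_simps; auto)
qed

lemma pair_mult_bilinear_right:
  assumes v: "v \<in> bilinear_subspace n" and w: "w \<in> pair_space n"
  shows "pair_mult n w v \<in> bilinear_subspace n"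
proof -
  have "pair_extend (pair_prod n (a, b)) v \<in> bilinear_subspace n"
    if "(a, b) \<in> Poly_Mapping.keys w" for a b
  proof -
    have ab: "a \<in> carrier (dsa n)" "b \<in> carrier (dsa n)"
      using that w by (auto simp: pair_space_def)
    show ?thesis
      unfolding pair_extend_prod
      by (intro bilinear_subspace_simps pair_extend_linear_bilinear[OF _ _ v] dsa_linear_lmult
          dsa_linear_comp[OF dsa_linear_lmult dsa_linear_part] dsa_part_closed ab)
  qed
  then show ?thesis
    unfolding pair_mult_extend
    by (subst pair_extend_def) (intro bilinear_subspace_simps; auto)
qed

section \<open>Classes and pure tensors\<close>

lemma tensor_class_mem: "u \<in> tensor_class n v \<longleftrightarrow> u - v \<in> bilinear_subspace n"
proof
  assume "u - v \<in> bilinear_subspace n"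
  moreover have "u = v + (u - v)" by simp
  ultimately show "u \<in> tensor_class n v" unfolding tensor_class_def by (rule rev_image_eqI)
qed (auto simp: tensor_class_def)

lemma tensor_class_eq: "tensor_class n v = tensor_class n w \<longleftrightarrow> v - w \<in> bilinear_subspace n"
proof
  assume "tensor_class n v = tensor_class n w"
  then show "v - w \<in> bilinear_subspace n"
    using tensor_class_mem[of v n v] bilinear_subspace_simps(1) tensor_class_mem[of v n w] by simp
next
  assume *: "v - w \<in> bilinear_subspace n"
  have "u - v \<in> bilinear_subspace n \<longleftrightarrow> u - w \<in> bilinear_subspace n" for u
    using bilinear_subspace_simps(2)[OF _ *, of "u - v"] bilinear_subspace_simps(3)[OF _ *, of "u - w"]
    by auto
  then show "tensor_class n v = tensor_class n w"
    by (auto simp: tensor_class_mem)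
qed

lemma tensor_class_self: "v \<in> tensor_class n v"
  by (simp add: tensor_class_mem bilinear_subspace_simps)

lemma tensor_carrier: "carrier (dsa_tensor n) = tensor_class n ` pair_space n"
  by (simp add: dsa_tensor_def)

lemma tensor_one: "\<one>\<^bsub>dsa_tensor n\<^esub> = tens n \<one>\<^bsub>dsa n\<^esub> \<one>\<^bsub>dsa n\<^esub>"
  by (simp add: dsa_tensor_def)

lemma tensor_zero: "\<zero>\<^bsub>dsa_tensor n\<^esub> = tensor_class n 0"
  by (simp add: dsa_tensor_def tensor_class_def)

lemma tensor_class_add:
  "tensor_class n v \<oplus>\<^bsub>dsa_tensor n\<^esub> tensor_class n w = tensor_class n (v + w)"
proof -
  have "tensor_class n (v' + w') = tensor_class n (v + w)"
    if "v' \<in> tensor_class n v" "w' \<in> tensor_class n w" for v' w'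
    using bilinear_subspace_simps(2)[OF that[unfolded tensor_class_mem]]
    by (simp add: tensor_class_eq algebra_simps)
  then show ?thesis
    unfolding dsa_tensor_def ring.simps monoid.simps
    by (rule UN_UN_const[OF tensor_class_self tensor_class_self])
qed

lemma tensor_class_mult:
  assumes v: "v \<in> pair_space n" and w: "w \<in> pair_space n"
  shows "tensor_class n v \<otimes>\<^bsub>dsa_tensor n\<^esub> tensor_class n w = tensor_class n (pair_mult n v w)"
proof -
  have "tensor_class n (pair_mult n v' w') = tensor_class n (pair_mult n v w)"
    if v': "v' \<in> tensor_class n v" and w': "w' \<in> tensor_class n w" for v' w'
  proof -
    \<comment> \<open>A representative from the coset has its support in the carrier, because the
      bilinear relations do.\<close>
    have "w' - w \<in> pair_space n"
      using w' bilinear_subspace_closed unfolding tensor_class_mem by blast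
    with w have w'c: "w' \<in> pair_space n"
      using pair.subspace_add[OF pair_space_subspace] by (metis diff_add_cancel)
    \<comment> \<open>The difference of the products v'w' and vw is rewritten as (v' - v)w' + v(w' -
      w), each term of which contains a relation.\<close>
    have "pair_mult n (v' - v) w' + pair_mult n v (w' - w) \<in> bilinear_subspace n"
      using v' w' unfolding tensor_class_mem
      by (intro bilinear_subspace_simps(2) pair_mult_bilinear_left pair_mult_bilinear_right v w'c)
    then show ?thesis
      by (simp add: tensor_class_eq pair_mult_diff_left pair_mult_diff_right)
  qed
  then show ?thesis
    unfolding dsa_tensor_def ring.simps monoid.simps
    by (rule UN_UN_const[OF tensor_class_self tensor_class_self])
qed

lemma tens_closed:
  "\<lbrakk>a \<in> carrier (dsa n); b \<in> carrier (dsa n)\<rbrakk> \<Longrightarrow> tens n a b \<in> carrier (dsa_tensor n)"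
  unfolding tens_def tensor_carrier by (intro imageI single_pair_space)

lemma tensor_class_single:
  "\<lbrakk>a \<in> carrier (dsa n); b \<in> carrier (dsa n)\<rbrakk> \<Longrightarrow>
    tensor_class n (Poly_Mapping.single (a, b) c) = tens n (dsa_scale n c a) b"
  unfolding tens_def
  by (rule tensor_class_eq[THEN iffD2, THEN sym]) (rule bilinear_relation)

lemma tens_add_left:
  assumes "a \<in> carrier (dsa n)" "a' \<in> carrier (dsa n)" "b \<in> carrier (dsa n)"
  shows "tens n (a \<oplus>\<^bsub>dsa n\<^esub> a') b = tens n a b \<oplus>\<^bsub>dsa_tensor n\<^esub> tens n a' b"
  using bilinear_relation(1)[OF assms(1,3,2)]
  unfolding tens_def tensor_class_add tensor_class_eq by (simp add: algebra_simps)

lemma tens_add_right: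
  assumes "a \<in> carrier (dsa n)" "b \<in> carrier (dsa n)" "b' \<in> carrier (dsa n)"
  shows "tens n a (b \<oplus>\<^bsub>dsa n\<^esub> b') = tens n a b \<oplus>\<^bsub>dsa_tensor n\<^esub> tens n a b'"
  using bilinear_relation(2)[OF assms]
  unfolding tens_def tensor_class_add tensor_class_eq by (simp add: algebra_simps)

text \<open>In the scaling relation for the scalar 0 the subtracted term vanishes, so the relation
  is the pair itself.\<close>

lemma single_zero_bilinear:
  fixes a :: "'p::prime_card dsa_elt"
  assumes a: "a \<in> carrier (dsa n)"
  shows "Poly_Mapping.single (\<zero>\<^bsub>dsa n\<^esub>, a) c \<in> bilinear_subspace n"
    and "Poly_Mapping.single (a, \<zero>\<^bsub>dsa n\<^esub>) c \<in> bilinear_subspace n"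
proof -
  interpret ring "dsa n :: 'p dsa_elt ring" by (rule dsa_ring)
  show "Poly_Mapping.single (\<zero>\<^bsub>dsa n\<^esub>, a) c \<in> bilinear_subspace n"
    using bilinear_subspace_simps(4)[OF bilinear_relation(3)[OF zero_closed a, of 0], of c]
    by (simp add: dsa_scale_zero)
  show "Poly_Mapping.single (a, \<zero>\<^bsub>dsa n\<^esub>) c \<in> bilinear_subspace n"
    using bilinear_subspace_simps(4)[OF bilinear_relation(4)[OF a zero_closed, of 0], of c]
    by (simp add: dsa_scale_zero)
qed

text \<open>For homogeneous inner factors three of the four signed terms contain a zero factor and
  vanish modulo the relations. The sign is stored as a scalar on the left factor, so that the result
  is again a pure tensor.\<close>

lemma tens_mult:
  fixes a b c d :: "'p::prime_card dsa_elt"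
  assumes a: "a \<in> carrier (dsa n)" and d: "d \<in> carrier (dsa n)"
    and b: "b \<in> dsa_homog n s" and c: "c \<in> dsa_homog n t" and st: "s \<in> {0, 1}" "t \<in> {0, 1}"
  shows "tens n a b \<otimes>\<^bsub>dsa_tensor n\<^esub> tens n c d =
    tens n (dsa_scale n ((- 1) ^ (s * t)) (a \<otimes>\<^bsub>dsa n\<^esub> c)) (b \<otimes>\<^bsub>dsa n\<^esub> d)"
proof -
  interpret ring "dsa n :: 'p dsa_elt ring" by (rule dsa_ring)
  note b' = dsa_homog_closed[OF b] and c' = dsa_homog_closed[OF c]
  note z = single_zero_bilinear[OF m_closed[OF a c']] single_zero_bilinear[OF m_closed[OF b' d]]
    single_zero_bilinear[OF zero_closed]
  have "pair_prod n (a, b) (c, d)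
      - Poly_Mapping.single (a \<otimes>\<^bsub>dsa n\<^esub> c, b \<otimes>\<^bsub>dsa n\<^esub> d) ((- 1) ^ (s * t)) \<in> bilinear_subspace n"
    using st a b' c' d
    by (auto simp: pair_prod_def dsa_part_homog_eq[OF b] dsa_part_homog_eq[OF c]
        intro!: bilinear_subspace_simps(2) z)
  then show ?thesis
    unfolding tensor_class_single[OF m_closed[OF a c'] m_closed[OF b' d], symmetric]
    unfolding tens_def tensor_class_mult[OF single_pair_space[OF a b'] single_pair_space[OF c' d]]
      pair_mult_single tensor_class_eq .
qed

section \<open>Ring axioms and characteristic of the tensor product\<close>

lemma pair_space_zero: "0 \<in> pair_space n"
  by (rule pair.subspace_0[OF pair_space_subspace])

lemma pair_space_add: "\<lbrakk>v \<in> pair_space n; w \<in> pair_space n\<rbrakk> \<Longrightarrow> v + w \<in> pair_space n"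
  by (rule pair.subspace_add[OF pair_space_subspace])

lemma dsa_tensor_abelian_group: "abelian_group (dsa_tensor n)"
proof (rule abelian_groupI)
  fix X Y :: "'a tensor_elt"
  assume "X \<in> carrier (dsa_tensor n)" "Y \<in> carrier (dsa_tensor n)"
  then obtain v w where vw: "v \<in> pair_space n" "w \<in> pair_space n"
    "X = tensor_class n v" "Y = tensor_class n w"
    unfolding tensor_carrier by blast
  show "X \<oplus>\<^bsub>dsa_tensor n\<^esub> Y \<in> carrier (dsa_tensor n)"
    unfolding vw(3,4) tensor_class_add tensor_carrier
    using vw(1,2) by (intro imageI pair_space_add)
  show "X \<oplus>\<^bsub>dsa_tensor n\<^esub> Y = Y \<oplus>\<^bsub>dsa_tensor n\<^esub> X"
    unfolding vw(3,4) tensor_class_add by (simp add: add.commute)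
  fix Z :: "'a tensor_elt"
  assume "Z \<in> carrier (dsa_tensor n)"
  then obtain u where u: "Z = tensor_class n u"
    unfolding tensor_carrier by blast
  show "X \<oplus>\<^bsub>dsa_tensor n\<^esub> Y \<oplus>\<^bsub>dsa_tensor n\<^esub> Z = X \<oplus>\<^bsub>dsa_tensor n\<^esub> (Y \<oplus>\<^bsub>dsa_tensor n\<^esub> Z)"
    unfolding vw(3,4) u tensor_class_add by (simp add: add.assoc)
next
  show "\<zero>\<^bsub>dsa_tensor n\<^esub> \<in> carrier (dsa_tensor n)"
    unfolding tensor_zero tensor_carrier by (intro imageI pair_space_zero)
next
  fix X :: "'a tensor_elt"
  assume "X \<in> carrier (dsa_tensor n)"
  then obtain v where v: "v \<in> pair_space n" "X = tensor_class n v"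
    unfolding tensor_carrier by blast
  show "\<zero>\<^bsub>dsa_tensor n\<^esub> \<oplus>\<^bsub>dsa_tensor n\<^esub> X = X"
    unfolding v(2) tensor_zero tensor_class_add by simp
  show "\<exists>Y\<in>carrier (dsa_tensor n). Y \<oplus>\<^bsub>dsa_tensor n\<^esub> X = \<zero>\<^bsub>dsa_tensor n\<^esub>"
    unfolding v(2) tensor_zero tensor_carrier
    by (rule bexI[of _ "tensor_class n (- v)"])
      (simp_all add: tensor_class_add pair.subspace_neg[OF pair_space_subspace v(1)])
qed

lemma tensor_mult_closed:
  "\<lbrakk>X \<in> carrier (dsa_tensor n); Y \<in> carrier (dsa_tensor n)\<rbrakk>
    \<Longrightarrow> X \<otimes>\<^bsub>dsa_tensor n\<^esub> Y \<in> carrier (dsa_tensor n)"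
  unfolding tensor_carrier using pair_mult_closed by (fastforce simp: tensor_class_mult)

lemma tensor_l_distr:
  assumes "X \<in> carrier (dsa_tensor n)" "Y \<in> carrier (dsa_tensor n)" "Z \<in> carrier (dsa_tensor n)"
  shows "(X \<oplus>\<^bsub>dsa_tensor n\<^esub> Y) \<otimes>\<^bsub>dsa_tensor n\<^esub> Z =
    X \<otimes>\<^bsub>dsa_tensor n\<^esub> Z \<oplus>\<^bsub>dsa_tensor n\<^esub> Y \<otimes>\<^bsub>dsa_tensor n\<^esub> Z"
  using assms unfolding tensor_carrier
  by (auto simp: tensor_class_add tensor_class_mult pair_space_add pair_mult_add_left)

lemma tensor_r_distr:
  assumes "X \<in> carrier (dsa_tensor n)" "Y \<in> carrier (dsa_tensor n)" "Z \<in> carrier (dsa_tensor n)"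
  shows "Z \<otimes>\<^bsub>dsa_tensor n\<^esub> (X \<oplus>\<^bsub>dsa_tensor n\<^esub> Y) =
    Z \<otimes>\<^bsub>dsa_tensor n\<^esub> X \<oplus>\<^bsub>dsa_tensor n\<^esub> Z \<otimes>\<^bsub>dsa_tensor n\<^esub> Y"
  using assms unfolding tensor_carrier
  by (auto simp: tensor_class_add tensor_class_mult pair_space_add pair_mult_add_right)

lemma tensor_l_null:
  assumes "X \<in> carrier (dsa_tensor n)"
  shows "\<zero>\<^bsub>dsa_tensor n\<^esub> \<otimes>\<^bsub>dsa_tensor n\<^esub> X = \<zero>\<^bsub>dsa_tensor n\<^esub>"
  using assms unfolding tensor_carrier tensor_zero
  by (auto simp: tensor_class_mult pair_space_zero pair_mult_extend)

lemma tensor_r_null: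
  assumes "X \<in> carrier (dsa_tensor n)"
  shows "X \<otimes>\<^bsub>dsa_tensor n\<^esub> \<zero>\<^bsub>dsa_tensor n\<^esub> = \<zero>\<^bsub>dsa_tensor n\<^esub>"
  using assms unfolding tensor_carrier tensor_zero
  by (auto simp: tensor_class_mult pair_space_zero pair_mult_swap)

text \<open>Homogeneous pure tensors generate the tensor product additively, and on them the product
  is given by \<open>tens_mult\<close> without any projections.\<close>

lemma tensor_induct [consumes 1, case_names zero add tens]:
  assumes X: "X \<in> carrier (dsa_tensor n)"
    and zero: "P \<zero>\<^bsub>dsa_tensor n\<^esub>"
    and add: "\<And>X Y. \<lbrakk>X \<in> carrier (dsa_tensor n); Y \<in> carrier (dsa_tensor n); P X; P Y\<rbrakk>
      \<Longrightarrow> P (X \<oplus>\<^bsub>dsa_tensor n\<^esub> Y)"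
    and tens: "\<And>s t a b. \<lbrakk>s \<in> {0, 1}; t \<in> {0, 1}; a \<in> dsa_homog n s; b \<in> dsa_homog n t\<rbrakk>
      \<Longrightarrow> P (tens n a b)"
  shows "P X"
proof -
  interpret T: abelian_group "dsa_tensor n :: 'a tensor_elt ring"
    by (rule dsa_tensor_abelian_group)
  \<comment> \<open>Membership in the carrier is carried along because the hypothesis
    \<open>add\<close> asks for it on both summands.\<close>
  let ?Q = "\<lambda>X. X \<in> carrier (dsa_tensor n) \<and> P X"
  have add': "?Q (X \<oplus>\<^bsub>dsa_tensor n\<^esub> Y)" if "?Q X" "?Q Y" for X Y
    using that add by blast
  from X obtain v where v: "v \<in> pair_space n" "X = tensor_class n v"
    unfolding tensor_carrier by blast
  have "?Q (tensor_class n v)"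
  proof (induction v rule: poly_mapping_additive_induct)
    case 1
    then show ?case using zero T.zero_closed unfolding tensor_zero by blast
  next
    case (2 f g)
    then show ?case using add' unfolding tensor_class_add[symmetric] by blast
  next
    case (3 k)
    then obtain a b where k: "k = (a, b)" and a: "a \<in> carrier (dsa n)" and b: "b \<in> carrier (dsa n)"
      using v(1) by (cases k) (auto simp: pair_space_def)
    \<comment> \<open>The coefficient is absorbed into the left factor, which leaves one pure
      tensor; splitting both factors by parity turns it into four homogeneous ones.\<close>
    let ?a = "dsa_scale n (Poly_Mapping.lookup v k) a"
    have a': "?a \<in> carrier (dsa n)" by (rule dsa_scale_closed[OF a])
    note p = dsa_part_closed[OF a'] dsa_part_closed[OF b] dsa_part_homog[OF a'] dsa_part_homog[OF b]
    have Q: "?Q (tens n (dsa_part n s ?a) (dsa_part n t b))" if "s \<in> {0, 1}" "t \<in> {0, 1}" for s t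
      using tens[OF that p(3)[OF that(1)] p(4)[OF that(2)]]
        tens_closed[OF p(1)[OF that(1)] p(2)[OF that(2)]] by blast
    have c: "dsa_part n 0 ?a \<in> carrier (dsa n)" "dsa_part n 1 ?a \<in> carrier (dsa n)"
      "dsa_part n 0 b \<in> carrier (dsa n)" "dsa_part n 1 b \<in> carrier (dsa n)"
      using p(1,2) by simp_all
    have bb: "dsa_part n 0 b \<oplus>\<^bsub>dsa n\<^esub> dsa_part n 1 b \<in> carrier (dsa n)"
      using dsa_part_decomp[OF b] b by simp
    have "tens n ?a b = tens n (dsa_part n 0 ?a \<oplus>\<^bsub>dsa n\<^esub> dsa_part n 1 ?a)
        (dsa_part n 0 b \<oplus>\<^bsub>dsa n\<^esub> dsa_part n 1 b)"
      using dsa_part_decomp[OF a'] dsa_part_decomp[OF b] by simp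
    also have "\<dots> = (tens n (dsa_part n 0 ?a) (dsa_part n 0 b)
          \<oplus>\<^bsub>dsa_tensor n\<^esub> tens n (dsa_part n 0 ?a) (dsa_part n 1 b))
        \<oplus>\<^bsub>dsa_tensor n\<^esub> (tens n (dsa_part n 1 ?a) (dsa_part n 0 b)
          \<oplus>\<^bsub>dsa_tensor n\<^esub> tens n (dsa_part n 1 ?a) (dsa_part n 1 b))"
      by (simp only: tens_add_left[OF c(1,2) bb] tens_add_right[OF c(1,3,4)] tens_add_right[OF c(2,3,4)])
    finally show ?case
      unfolding k tensor_class_single[OF a b] unfolding k[symmetric]
      by (simp only:) (intro add' Q; simp)
  qed
  then show ?thesis using v(2) by blast
qed

text \<open>Both sides are additive in each argument, so homogeneous pure tensors suffice; there
  associativity of the algebra leaves only the signs to compare.\<close>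

lemma tensor_m_assoc:
  fixes X Y Z :: "'p::prime_card tensor_elt"
  assumes X: "X \<in> carrier (dsa_tensor n)" and Y: "Y \<in> carrier (dsa_tensor n)"
    and Z: "Z \<in> carrier (dsa_tensor n)"
  shows "(X \<otimes>\<^bsub>dsa_tensor n\<^esub> Y) \<otimes>\<^bsub>dsa_tensor n\<^esub> Z = X \<otimes>\<^bsub>dsa_tensor n\<^esub> (Y \<otimes>\<^bsub>dsa_tensor n\<^esub> Z)"
  using X
proof (induction X rule: tensor_induct)
  case zero
  then show ?case using Y Z by (simp add: tensor_l_null tensor_mult_closed)
next
  case (add X X')
  then show ?case using Y Z by (simp add: tensor_l_distr tensor_mult_closed)
next
  case (tens i j a b)
  note ab = tens
  then have X: "tens n a b \<in> carrier (dsa_tensor n)" by (intro tens_closed dsa_homog_closed)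
  show ?case
    using Y
  proof (induction Y rule: tensor_induct)
    case zero
    then show ?case using X Z by (simp add: tensor_l_null tensor_r_null)
  next
    case (add Y Y')
    then show ?case using X Z by (simp add: tensor_l_distr tensor_r_distr tensor_mult_closed)
  next
    case (tens k l c d)
    note cd = tens
    then have Y: "tens n c d \<in> carrier (dsa_tensor n)" by (intro tens_closed dsa_homog_closed)
    show ?case
      using Z
    proof (induction Z rule: tensor_induct)
      case zero
      then show ?case using X Y by (simp add: tensor_r_null tensor_mult_closed)
    next
      case (add Z Z')
      then show ?case using X Y by (simp add: tensor_r_distr tensor_mult_closed)
    next
      case (tens m q e f)
      interpret ring "dsa n :: 'p dsa_elt ring" by (rule dsa_ring)
      have cl: "a \<in> carrier (dsa n)" "b \<in> carrier (dsa n)" "c \<in> carrier (dsa n)"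
        "d \<in> carrier (dsa n)" "e \<in> carrier (dsa n)" "f \<in> carrier (dsa n)"
        using ab cd tens by (auto dest: dsa_homog_closed)
      note m1 = tens_mult[OF cl(1,4) ab(4) cd(3) ab(2) cd(1)]
      have m2: "tens n (dsa_scale n ((- 1) ^ (j * k)) (a \<otimes>\<^bsub>dsa n\<^esub> c)) (b \<otimes>\<^bsub>dsa n\<^esub> d)
          \<otimes>\<^bsub>dsa_tensor n\<^esub> tens n e f
        = tens n (dsa_scale n ((- 1) ^ ((j + l) mod 2 * m))
            (dsa_scale n ((- 1) ^ (j * k)) (a \<otimes>\<^bsub>dsa n\<^esub> c) \<otimes>\<^bsub>dsa n\<^esub> e)) (b \<otimes>\<^bsub>dsa n\<^esub> d \<otimes>\<^bsub>dsa n\<^esub> f)"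
        by (rule tens_mult[OF _ cl(6) dsa_homog_mult[OF ab(4) cd(4)] tens(3) _ tens(1)])
          (use cl in \<open>auto intro: dsa_scale_closed\<close>)
      note m3 = tens_mult[OF cl(3,6) cd(4) tens(3) cd(2) tens(1)]
      have m4: "tens n a b \<otimes>\<^bsub>dsa_tensor n\<^esub>
          tens n (dsa_scale n ((- 1) ^ (l * m)) (c \<otimes>\<^bsub>dsa n\<^esub> e)) (d \<otimes>\<^bsub>dsa n\<^esub> f)
        = tens n (dsa_scale n ((- 1) ^ (j * ((k + m) mod 2)))
            (a \<otimes>\<^bsub>dsa n\<^esub> dsa_scale n ((- 1) ^ (l * m)) (c \<otimes>\<^bsub>dsa n\<^esub> e))) (b \<otimes>\<^bsub>dsa n\<^esub> (d \<otimes>\<^bsub>dsa n\<^esub> f))"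
        by (rule tens_mult[OF cl(1) _ ab(4) dsa_scale_homog[OF dsa_homog_mult[OF cd(3) tens(3)]] ab(2)])
          (use cl in auto)
      \<comment> \<open>Modulo 2 both exponents are jk + jm + lm; the reductions
        \<open>mod 2\<close> come from the parities of the products b d and c e.\<close>
      have "(- 1) ^ ((j + l) mod 2 * m) * (- 1) ^ (j * k)
          = ((- 1) ^ (j * ((k + m) mod 2)) * (- 1) ^ (l * m) :: 'p mod_ring)"
        using ab cd tens by auto
      then show ?case
        unfolding m1 m2 m3 m4 using cl
        by (simp add: dsa_scale_lmult dsa_scale_rmult dsa_scale_scale m_assoc)
    qed
  qed
qed

lemma tensor_one_mult:
  fixes X :: "'p::prime_card tensor_elt"
  assumes "X \<in> carrier (dsa_tensor n)"
  shows "\<one>\<^bsub>dsa_tensor n\<^esub> \<otimes>\<^bsub>dsa_tensor n\<^esub> X = X" "X \<otimes>\<^bsub>dsa_tensor n\<^esub> \<one>\<^bsub>dsa_tensor n\<^esub> = X"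
proof -
  interpret ring "dsa n :: 'p dsa_elt ring" by (rule dsa_ring)
  have one: "(\<one>\<^bsub>dsa_tensor n\<^esub> :: 'p tensor_elt) \<in> carrier (dsa_tensor n)"
    unfolding tensor_one by (intro tens_closed one_closed)
  have "\<one>\<^bsub>dsa_tensor n\<^esub> \<otimes>\<^bsub>dsa_tensor n\<^esub> X = X \<and> X \<otimes>\<^bsub>dsa_tensor n\<^esub> \<one>\<^bsub>dsa_tensor n\<^esub> = X"
    using assms
  proof (induction X rule: tensor_induct)
    case zero
    then show ?case using one by (simp add: tensor_l_null tensor_r_null)
  next
    case (add X Y)
    then show ?case using one by (simp add: tensor_l_distr tensor_r_distr)
  next
    case (tens s t a b)
    then have cl: "a \<in> carrier (dsa n)" "b \<in> carrier (dsa n)" by (auto dest: dsa_homog_closed)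
    then show ?case
      unfolding tensor_one
      using tens_mult[OF one_closed cl(2) dsa_homog_one tens(3) _ tens(1)]
        tens_mult[OF cl(1) one_closed tens(4) dsa_homog_one tens(2)]
      by (simp add: dsa_scale_one)
  qed
  then show "\<one>\<^bsub>dsa_tensor n\<^esub> \<otimes>\<^bsub>dsa_tensor n\<^esub> X = X" "X \<otimes>\<^bsub>dsa_tensor n\<^esub> \<one>\<^bsub>dsa_tensor n\<^esub> = X"
    by blast+
qed

lemma dsa_tensor_ring: "ring (dsa_tensor n :: 'p::prime_card tensor_elt ring)"
proof (rule ringI)
  interpret ring "dsa n :: 'p dsa_elt ring" by (rule dsa_ring)
  have one: "(\<one>\<^bsub>dsa_tensor n\<^esub> :: 'p tensor_elt) \<in> carrier (dsa_tensor n)"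
    unfolding tensor_one by (intro tens_closed one_closed)
  show "Group.monoid (dsa_tensor n :: 'p tensor_elt ring)"
    by (rule monoidI) (simp_all add: one tensor_mult_closed tensor_m_assoc tensor_one_mult)
qed (simp_all add: dsa_tensor_abelian_group tensor_l_distr tensor_r_distr)

text \<open>A k-fold sum of a class is the class of the combination scaled by the image of k in the
  field, which is 0 for k = p.\<close>

lemma dsa_tensor_char:
  fixes X :: "'p::prime_card tensor_elt"
  assumes "X \<in> carrier (dsa_tensor n)"
  shows "[CARD('p)] \<cdot>\<^bsub>dsa_tensor n\<^esub> X = \<zero>\<^bsub>dsa_tensor n\<^esub>"
proof -
  interpret ring "dsa_tensor n :: 'p tensor_elt ring" by (rule dsa_tensor_ring)
  from assms obtain v where v: "X = tensor_class n v"
    unfolding tensor_carrier by blast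
  have "[k] \<cdot>\<^bsub>dsa_tensor n\<^esub> X = tensor_class n (pair_scale (of_nat k) v)" for k :: nat
  proof (induction k)
    case 0
    then show ?case by (simp add: tensor_zero)
  next
    case (Suc k)
    then show ?case
      by (simp add: v tensor_class_add pair.scale_left_distrib add.commute)
  qed
  moreover have "of_nat CARD('p) = (0 :: 'p mod_ring)"
    by (simp add: of_nat_eq_0_iff_char_dvd)
  ultimately show ?thesis by (simp add: tensor_zero)
qed

lemma tens_mult_even:
  fixes a b c d :: "'p::prime_card dsa_elt"
  assumes "a \<in> carrier (dsa n)" "d \<in> carrier (dsa n)" "b \<in> dsa_homog n 0" "c \<in> dsa_homog n 0"
  shows "tens n a b \<otimes>\<^bsub>dsa_tensor n\<^esub> tens n c d = tens n (a \<otimes>\<^bsub>dsa n\<^esub> c) (b \<otimes>\<^bsub>dsa n\<^esub> d)"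
proof -
  interpret ring "dsa n :: 'p dsa_elt ring" by (rule dsa_ring)
  show ?thesis
    using tens_mult[OF assms] dsa_scale_one[OF m_closed[OF assms(1) dsa_homog_closed[OF assms(4)]]]
    by simp
qed

lemma tens_pow_even:
  fixes a b :: "'p::prime_card dsa_elt"
  assumes a: "a \<in> dsa_homog n 0" and b: "b \<in> dsa_homog n 0"
  shows "tens n a b [^]\<^bsub>dsa_tensor n\<^esub> (k::nat) = tens n (a [^]\<^bsub>dsa n\<^esub> k) (b [^]\<^bsub>dsa n\<^esub> k)"
proof (induction k)
  case 0
  then show ?case by (simp add: tensor_one)
next
  case (Suc k)
  then show ?case
    using tens_mult_even[OF dsa_homog_closed[OF dsa_homog_pow[OF a]] dsa_homog_closed[OF b]
        dsa_homog_pow[OF b] a]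
    by simp
qed

section \<open>Paths in the labelled graph\<close>

lemma vertex_exponent: "p \<ge> 2 \<Longrightarrow> vertex_exponent p (2 * p ^ a) = a"
  unfolding vertex_exponent_def by (rule the_equality) auto

text \<open>This separates the vertex 1 from all the others, so that the test \<open>v = 1\<close>
  in \<open>edge_label\<close> picks out exactly the edges labelled by \<tau>.\<close>

lemma one_less_vertex: "p \<ge> 2 \<Longrightarrow> 1 < 2 * p ^ a" for p :: nat
proof -
  assume "p \<ge> 2"
  then have "p ^ a > 0" by simp
  then show ?thesis by linarith
qed

lemma K_edges_vertex:
  assumes "p \<ge> 2" "b \<le> n"
  shows "(2 * p ^ a, 2 * p ^ b) \<in> K_edges p n \<longleftrightarrow> a < b"
    and "(1, 2 * p ^ b) \<in> K_edges p n"
  using assms one_less_vertex[OF assms(1), of b]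
  by (auto simp: K_edges_def K_verts_def)

text \<open>A path is determined by its middle vertex, and the vertices lie in the order of their
  exponents. Proper middle vertices have 0 < k < i; the two ends of the range supply the
  loops.\<close>

lemma paths2_xi:
  assumes p: "p \<ge> 2" and i: "1 \<le> i" "i + j \<le> n"
  shows "paths2 p n (2 * p ^ j) (2 * p ^ (i + j)) =
    (\<lambda>k. ((2 * p ^ j, 2 * p ^ (j + k)), (2 * p ^ (j + k), 2 * p ^ (i + j)))) ` {0..i}"
    (is "_ = ?f ` _")
proof -
  have "nondegenerate_paths2 p n (2 * p ^ j) (2 * p ^ (i + j)) = ?f ` {0<..<i}"
  proof (intro equalityI subsetI)
    fix P assume "P \<in> nondegenerate_paths2 p n (2 * p ^ j) (2 * p ^ (i + j))"
    then obtain w where P: "P = ((2 * p ^ j, w), (w, 2 * p ^ (i + j)))"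
      and w: "w \<in> K_verts p n" "2 * p ^ j < w" "w < 2 * p ^ (i + j)"
      by (auto simp: nondegenerate_paths2_def K_edges_def)
    \<comment> \<open>The vertex 1 lies below the source, so it cannot be the middle vertex.\<close>
    from w(1,2) one_less_vertex[OF p, of j] obtain a where a: "w = 2 * p ^ a"
      by (auto simp: K_verts_def)
    with w p have "j < a" "a < i + j" by auto
    then show "P \<in> ?f ` {0<..<i}"
      unfolding P a by (intro image_eqI[of _ _ "a - j"]) auto
  next
    fix P assume "P \<in> ?f ` {0<..<i}"
    then show "P \<in> nondegenerate_paths2 p n (2 * p ^ j) (2 * p ^ (i + j))"
      using i by (auto simp: nondegenerate_paths2_def K_edges_vertex[OF p])
  qed
  moreover have "degenerate_paths2 p n (2 * p ^ j) (2 * p ^ (i + j)) = ?f ` {0, i}"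
    using i by (simp add: degenerate_paths2_def K_edges_vertex[OF p] add.commute)
  moreover have "{0..i} = {0<..<i} \<union> {0, i}" using i by auto
  ultimately show ?thesis unfolding paths2_def by (simp only: image_Un)
qed

lemma paths2_tau:
  assumes p: "p \<ge> 2" and i: "i \<le> n"
  shows "paths2 p n 1 (2 * p ^ i) =
    insert ((1, 1), (1, 2 * p ^ i)) ((\<lambda>k. ((1, 2 * p ^ k), (2 * p ^ k, 2 * p ^ i))) ` {0..i})"
    (is "_ = insert _ (?f ` _)")
proof -
  \<comment> \<open>Here the range starts at 0: the source is 1, so for positive i the vertex 2 is a
    proper middle vertex. The loop at 1 has no index k, since 1 is not of the form
    \<open>2 * p ^ k\<close>.\<close>
  have "nondegenerate_paths2 p n 1 (2 * p ^ i) = ?f ` {0..<i}"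
  proof (intro equalityI subsetI)
    fix P assume "P \<in> nondegenerate_paths2 p n 1 (2 * p ^ i)"
    then obtain w where P: "P = ((1, w), (w, 2 * p ^ i))"
      and w: "w \<in> K_verts p n" "1 < w" "w < 2 * p ^ i"
      by (auto simp: nondegenerate_paths2_def K_edges_def)
    from w(1,2) obtain a where a: "w = 2 * p ^ a"
      by (auto simp: K_verts_def)
    with w p have "a < i" by auto
    then show "P \<in> ?f ` {0..<i}"
      unfolding P a by auto
  next
    fix P assume "P \<in> ?f ` {0..<i}"
    then show "P \<in> nondegenerate_paths2 p n 1 (2 * p ^ i)"
      using i by (auto simp: nondegenerate_paths2_def K_edges_vertex[OF p] K_edges_vertex(2)[OF p, unfolded One_nat_def])
  qed
  moreover have "degenerate_paths2 p n 1 (2 * p ^ i) = insert ((1, 1), (1, 2 * p ^ i)) (?f ` {i})"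
    using K_edges_vertex(2)[OF p i] by (simp add: degenerate_paths2_def)
  moreover have "{0..i} = {0..<i} \<union> {i}" by auto
  ultimately show ?thesis unfolding paths2_def by (simp only: image_Un image_insert image_empty Un_insert_right)
qed

text \<open>The case a = b is included: the label 1 of a loop agrees with a power of \<xi> of index
  0. Thus one formula serves degenerate and nondegenerate paths.\<close>

lemma edge_label_xi:
  fixes a b :: nat
  assumes "a \<le> b"
  shows "edge_label n (2 * CARD('p) ^ a, 2 * CARD('p) ^ b) =
    (xi n (b - a) [^]\<^bsub>dsa n\<^esub> (CARD('p) ^ a) :: 'p::prime_card dsa_elt)"
proof -
  interpret ring "dsa n :: 'p dsa_elt ring" by (rule dsa_ring)
  have p: "CARD('p) \<ge> 2" by (rule prime_ge_2_nat[OF prime_card])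
  then show ?thesis
    using one_less_vertex[OF p, of a] by (auto simp: vertex_exponent xi_def)
qed

lemma edge_label_tau:
  "edge_label n (1, 2 * CARD('p) ^ b) = (tau n b :: 'p::prime_card dsa_elt)"
proof -
  have p: "CARD('p) \<ge> 2" by (rule prime_ge_2_nat[OF prime_card])
  then show ?thesis
    using one_less_vertex[OF p, of b] by (auto simp: vertex_exponent)
qed

section \<open>Coproducts as sums over paths\<close>

theorem theorem3p17:
  fixes p n :: nat
    and \<psi> :: "'p::prime_card dsa_elt \<Rightarrow> 'p tensor_elt"
  assumes "p = CARD('p)" and "odd p"
    and "is_coproduct n \<psi>"
  shows "(\<forall>i j. 1 \<le> i \<and> i + j \<le> n \<longrightarrow>
            \<psi> (xi n i [^]\<^bsub>dsa n\<^esub> (p ^ j)) =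
            (\<Oplus>\<^bsub>dsa_tensor n\<^esub>P\<in>paths2 p n (2 * p ^ j) (2 * p ^ (i + j)). path_tensor n P))
       \<and> (\<forall>i \<le> n.
            \<psi> (tau n i) =
            (\<Oplus>\<^bsub>dsa_tensor n\<^esub>P\<in>paths2 p n 1 (2 * p ^ i). path_tensor n P))"
proof (intro conjI allI impI)
  interpret D: ring "dsa n :: 'p dsa_elt ring" by (rule dsa_ring)
  interpret T: ring "dsa_tensor n :: 'p tensor_elt ring" by (rule dsa_tensor_ring)
  have prime: "Factorial_Ring.prime p" unfolding assms(1) by (rule prime_card)
  note p2 = prime_ge_2_nat[OF prime]
  have hom: "\<psi> \<in> Ring.ring_hom (dsa n) (dsa_tensor n)"
    and psi_xi: "\<And>m. m \<in> {1..n} \<Longrightarrow> \<psi> (xi n m) =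
      (\<Oplus>\<^bsub>dsa_tensor n\<^esub>k\<in>{0..m}. tens n (xi n (m - k) [^]\<^bsub>dsa n\<^esub> (p ^ k)) (xi n k))"
    and psi_tau: "\<And>m. m \<le> n \<Longrightarrow> \<psi> (tau n m) =
      tens n (tau n m) \<one>\<^bsub>dsa n\<^esub> \<oplus>\<^bsub>dsa_tensor n\<^esub>
      (\<Oplus>\<^bsub>dsa_tensor n\<^esub>k\<in>{0..m}. tens n (xi n (m - k) [^]\<^bsub>dsa n\<^esub> (p ^ k)) (tau n k))"
    using assms unfolding is_coproduct_def by auto
  {
    fix i j assume ij: "1 \<le> i \<and> i + j \<le> n"
    let ?e = "\<lambda>k. xi n (i - k) [^]\<^bsub>dsa n\<^esub> (p ^ k) :: 'p dsa_elt"
    let ?t = "\<lambda>k. tens n (?e k) (xi n k :: 'p dsa_elt)"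
    let ?path = "\<lambda>k. ((2 * p ^ j, 2 * p ^ (j + k)), (2 * p ^ (j + k), 2 * p ^ (i + j)))"
    have homog: "?e k \<in> dsa_homog n 0" "xi n k \<in> dsa_homog n 0" if "k \<le> i" for k
      using that ij by (intro dsa_homog_pow xi_homog; linarith)+
    note cl = dsa_homog_closed[OF homog(1)] dsa_homog_closed[OF homog(2)]
    have tcl: "?t k \<in> carrier (dsa_tensor n)" if "k \<in> {0..i}" for k
      using that by (intro tens_closed cl) auto
    have ecomm: "?e k \<otimes>\<^bsub>dsa n\<^esub> ?e l = ?e l \<otimes>\<^bsub>dsa n\<^esub> ?e k" if "k \<le> i" "l \<le> i" for k l
    proof -
      have x: "(xi n (i - k) :: 'p dsa_elt) \<in> carrier (dsa n)" "(xi n (i - l) :: 'p dsa_elt) \<in> carrier (dsa n)"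
        and c: "xi n (i - k) \<otimes>\<^bsub>dsa n\<^esub> xi n (i - l) = xi n (i - l) \<otimes>\<^bsub>dsa n\<^esub> (xi n (i - k) :: 'p dsa_elt)"
        using ij by (intro xi_closed xi_commute; linarith)+
      \<comment> \<open>The power is taken on one side first and then, after exchanging the sides,
        on the other.\<close>
      have "?e k \<otimes>\<^bsub>dsa n\<^esub> xi n (i - l) = xi n (i - l) \<otimes>\<^bsub>dsa n\<^esub> ?e k"
        by (rule D.group_commutes_pow[OF c x])
      from D.group_commutes_pow[OF this[symmetric] x(2) D.nat_pow_closed[OF x(1)]]
      show ?thesis by (rule sym)
    qed
    have tcomm: "?t k \<otimes>\<^bsub>dsa_tensor n\<^esub> ?t l = ?t l \<otimes>\<^bsub>dsa_tensor n\<^esub> ?t k"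
      if "k \<in> {0..i}" "l \<in> {0..i}" for k l
    proof -
      have kl: "k \<le> i" "l \<le> i" using that by auto
      moreover have "xi n k \<otimes>\<^bsub>dsa n\<^esub> xi n l = xi n l \<otimes>\<^bsub>dsa n\<^esub> (xi n k :: 'p dsa_elt)"
        using kl ij by (intro xi_commute) auto
      ultimately show ?thesis
        using ecomm[OF kl] by (simp add: tens_mult_even homog cl)
    qed
    have label: "?t k [^]\<^bsub>dsa_tensor n\<^esub> (p ^ j) = path_tensor n (?path k)" if "k \<in> {0..i}" for k
    proof -
      have k: "k \<le> i" using that by auto
      have xk: "(xi n (i - k) :: 'p dsa_elt) \<in> carrier (dsa n)"
        using ij by (intro xi_closed) linarith
      have "?t k [^]\<^bsub>dsa_tensor n\<^esub> (p ^ j) =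
          tens n (xi n (i - k) [^]\<^bsub>dsa n\<^esub> (p ^ (j + k))) (xi n k [^]\<^bsub>dsa n\<^esub> (p ^ j))"
        unfolding tens_pow_even[OF homog[OF k]] D.nat_pow_pow[OF xk]
        by (simp add: power_add mult.commute)
      \<comment> \<open>The label of the second edge stands on the left: the exponents j + k and i +
        j differ by i - k, while those of the first edge, j and j + k, differ by k.\<close>
      also have "\<dots> = path_tensor n (?path k)"
        using k unfolding path_tensor_def assms(1) prod.case
        by (subst edge_label_xi, simp, subst edge_label_xi, simp, simp add: add.commute)
      finally show ?thesis .
    qed
    \<comment> \<open>The sum ranges over a set of paths, so distinct indices must give distinct
      paths for no term to be lost; powers of p \<ge> 2 are injective in the exponent.\<close>
    have inj: "inj_on ?path {0..i}"
      using p2 by (auto intro!: inj_onI)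
    have "\<psi> (xi n i [^]\<^bsub>dsa n\<^esub> (p ^ j)) = \<psi> (xi n i) [^]\<^bsub>dsa_tensor n\<^esub> (p ^ j)"
      using ij by (intro ring_hom_nat_pow[OF hom D.is_monoid] xi_closed) auto
    also have "\<dots> = (\<Oplus>\<^bsub>dsa_tensor n\<^esub>k\<in>{0..i}. ?t k) [^]\<^bsub>dsa_tensor n\<^esub> (p ^ j)"
      using ij by (subst psi_xi) auto
    also have "\<dots> = (\<Oplus>\<^bsub>dsa_tensor n\<^esub>k\<in>{0..i}. ?t k [^]\<^bsub>dsa_tensor n\<^esub> (p ^ j))"
      by (rule T.frobenius_power_finsum[OF prime _ _ tcl tcomm])
        (simp_all add: assms(1) dsa_tensor_char)
    also have "\<dots> = (\<Oplus>\<^bsub>dsa_tensor n\<^esub>k\<in>{0..i}. path_tensor n (?path k))"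
      using tcl label by (intro T.finsum_cong') (auto simp flip: label)
    also have "\<dots> = (\<Oplus>\<^bsub>dsa_tensor n\<^esub>P\<in>?path ` {0..i}. path_tensor n P)"
      using tcl by (intro T.finsum_reindex[symmetric] inj) (auto simp flip: label)
    finally show "\<psi> (xi n i [^]\<^bsub>dsa n\<^esub> (p ^ j)) =
        (\<Oplus>\<^bsub>dsa_tensor n\<^esub>P\<in>paths2 p n (2 * p ^ j) (2 * p ^ (i + j)). path_tensor n P)"
      using ij by (simp only: paths2_xi[OF p2])
  }
  {
    fix i assume i: "i \<le> n"
    let ?t = "\<lambda>k. tens n (xi n (i - k) [^]\<^bsub>dsa n\<^esub> (p ^ k)) (tau n k :: 'p dsa_elt)"
    let ?path = "\<lambda>k. ((1, 2 * p ^ k), (2 * p ^ k, 2 * p ^ i))"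
    let ?loop = "((1, 1), (1, 2 * p ^ i))"
    have tcl: "?t k \<in> carrier (dsa_tensor n)" if "k \<in> {0..i}" for k
      using that i by (intro tens_closed D.nat_pow_closed xi_closed tau_closed) auto
    have label: "?t k = path_tensor n (?path k)" if "k \<in> {0..i}" for k
      using that unfolding path_tensor_def assms(1) prod.case edge_label_tau
      by (subst edge_label_xi) auto
    have loop: "tens n (tau n i) \<one>\<^bsub>dsa n\<^esub> = (path_tensor n ?loop :: 'p tensor_elt)"
      unfolding path_tensor_def assms(1) prod.case edge_label_tau by simp
    have loop_cl: "(path_tensor n ?loop :: 'p tensor_elt) \<in> carrier (dsa_tensor n)"
      unfolding loop[symmetric] using i by (intro tens_closed tau_closed D.one_closed)
    have inj: "inj_on ?path {0..i}"
      using p2 by (auto intro!: inj_onI)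
    \<comment> \<open>The first edge of this path ends at 1, and those of all the others end at a
      vertex greater than 1, so its term is added exactly once.\<close>
    have notin: "?loop \<notin> ?path ` {0..i}"
      using one_less_vertex[OF p2] by auto
    have pcl: "path_tensor n \<in> ?path ` {0..i} \<rightarrow> carrier (dsa_tensor n :: 'p tensor_elt ring)"
      using tcl by (auto simp only: label)
    have "(\<Oplus>\<^bsub>dsa_tensor n\<^esub>k\<in>{0..i}. ?t k) = (\<Oplus>\<^bsub>dsa_tensor n\<^esub>k\<in>{0..i}. path_tensor n (?path k))"
      using tcl by (intro T.finsum_cong') (auto simp only: label)
    also have "\<dots> = (\<Oplus>\<^bsub>dsa_tensor n\<^esub>P\<in>?path ` {0..i}. path_tensor n P)"
      by (rule T.finsum_reindex[OF pcl inj, symmetric])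
    finally have "\<psi> (tau n i) = path_tensor n ?loop \<oplus>\<^bsub>dsa_tensor n\<^esub>
        (\<Oplus>\<^bsub>dsa_tensor n\<^esub>P\<in>?path ` {0..i}. path_tensor n P)"
      unfolding psi_tau[OF i] loop by (rule arg_cong)
    also have "\<dots> = (\<Oplus>\<^bsub>dsa_tensor n\<^esub>P\<in>insert ?loop (?path ` {0..i}). path_tensor n P)"
      by (rule T.finsum_insert[OF _ notin pcl loop_cl, symmetric]) simp
    finally show "\<psi> (tau n i) = (\<Oplus>\<^bsub>dsa_tensor n\<^esub>P\<in>paths2 p n 1 (2 * p ^ i). path_tensor n P)"
      by (simp only: paths2_tau[OF p2 i])
  }
qed

end
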